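(* Let $\mathbf{X}=(X_n)_{n\in\mathbb{Z}}$ and $\mathbf{Y}=(Y_n)_{n\in\mathbb{Z}}$ be two stationary chains of infinite order on $\mathcal{A}=\{0,1\}$ with transition probabilities $p^X$ and $p^Y$ such that: $p^X(1\mid x_{-\infty}^{-1})\le p^Y(1\mid y_{-\infty}^{-1})$ whenever $x_{-\infty}^{-1}\le y_{-\infty}^{-1}$ (ordering); $\max\{\beta^X(k),\beta^Y(k)\}\to0$ as $k\to\infty$, where $\beta^X(k)=\max_{a\in\mathcal{A}}\sup\{|p^X(a\mid x_{-\infty}^{-1})-p^X(a\mid y_{-\infty}^{-1})|: x_{-k}^{-1}=y_{-k}^{-1}\}$ and similarly for $\beta^Y$ (continuity); and $\prod_{k\ge0}\alpha_k>0$, where the numbers $\alpha_k$ are defined from $p^X$ and $p^Y$ as in the context. With the decomposition of the coupled kernel $P$ into $(\lambda_k)$, $(P_k)$, the iid variables $(L_n)_{n\in\mathbb{Z}}$, and the perfect simulation algorithm described in the context, for every pair of integers $m\le n$ let $$T[m,n]=\sup\{t\le m:\ L_s\le s-t\ \text{ for all } s=t,\dots,n\}.$$ Then: (a) $T[m,n]$ is almost surely finite. (b) For every integer $t\le m$, the event $\{T[m,n]=t\}$ is measurable with respect to the $\sigma$-algebra generated by the random variables $L_s$, $t\le s\le n$. (c) The perfect simulation algorithm with input $(m,n)$ stops almost surely after a finite number of steps. (d) The sequence $(\tilde X_m^n,\tilde Y_m^n)$ produced by the algorithm is a perfect sample of the minimal $\bar d$-coupling $(\hat X_j,\hat Y_j)_{j\in\mathbb{Z}}$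 of $\mathbf{X}$ and $\mathbf{Y}$ constructed in the context, i.e. $(\tilde X_m^n,\tilde Y_m^n)$ has the same law as $(\hat X_m^n,\hat Y_m^n)$.
   Context: **Chains.** For integers $m\le n$, $x_m^n=(x_m,\dots,x_n)$; $x_{-\infty}^{-1}=(x_i)_{i\le -1}$ is called a past, and $\mathcal{A}_{-\infty}^{-1}$ is the set of pasts. $\mathbb{N}=\{0,1,2,\dots\}$. That $\mathbf{X}$ is a stationary chain of infinite order with transition probabilities $p^X$ means that $\mathbf X$ is stationary and $p^X(a\mid x_{-\infty}^{-1})$ is a (regular) version of $\mathbb{P}(X_0=a\mid X_{-\infty}^{-1}=x_{-\infty}^{-1})$, defined for every past and every $a\in\mathcal{A}$; similarly for $\mathbf{Y}$ and $p^Y$. Write $x_{-\infty}^{-1}\le y_{-\infty}^{-1}$ if $x_n\le y_n$ for all $n\le -1$. **Coupled kernel.** Let $\mathcal{S}=\{(0,0),(0,1),(1,1)\}$; $\mathcal{S}_{-\infty}^{-1}$ (resp. $\mathcal{S}_{-k}^{-1}$) is the set of $\mathcal S$-valued sequences indexed by $i\le-1$ (resp. $-k\le i\le -1$), identified with ordered pairs of pasts (resp. strings) $(x,y)$. For $(x_{-\infty}^{-1},y_{-\infty}^{-1})\in\mathcal{S}_{-\infty}^{-1}$ define $P((1,1)\mid(x_{-\infty}^{-1},y_{-\infty}^{-1}))=p^X(1\mid x_{-\infty}^{-1})$, $P((0,0)\mid(x_{-\infty}^{-1},y_{-\infty}^{-1}))=p^Y(0\mid y_{-\infty}^{-1})$,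 $P((0,1)\mid(x_{-\infty}^{-1},y_{-\infty}^{-1}))=p^X(0\mid x_{-\infty}^{-1})-p^Y(0\mid y_{-\infty}^{-1})$. For $(a,b)\in\mathcal{S}$ put $r_0((a,b))=\inf\{P((a,b)\mid w): w\in\mathcal{S}_{-\infty}^{-1}\}$, and for $k\ge1$, $r_k((a,b)\mid(x_{-k}^{-1},y_{-k}^{-1}))=\inf\{P((a,b)\mid(u_{-\infty}^{-1},v_{-\infty}^{-1})):(u_{-\infty}^{-1},v_{-\infty}^{-1})\in\mathcal{S}_{-\infty}^{-1},\,u_{-k}^{-1}=x_{-k}^{-1},\,v_{-k}^{-1}=y_{-k}^{-1}\}$. Put $\alpha_0=\sum_{(a,b)\in\mathcal{S}}r_0((a,b))$ and, for $k\ge1$, $\alpha_k=\inf\{\sum_{(a,b)\in\mathcal{S}}r_k((a,b)\mid(x_{-k}^{-1},y_{-k}^{-1})):(x_{-k}^{-1},y_{-k}^{-1})\in\mathcal{S}_{-k}^{-1}\}$. **Decomposition.** Let $\lambda_0=\alpha_0$ and $\lambda_k=\alpha_k-\alpha_{k-1}$ for $k\ge1$; since $\max\{\beta^X(k),\beta^Y(k)\}\to0$, $(\lambda_k)_{k\in\mathbb{N}}$ is a probability distribution. Fix a probability measure $P_0$ on $\mathcal{S}$ and transition probabilities $P_k$ on $\mathcal{S}\times\mathcal{S}_{-k}^{-1}$, $k\ge1$, such that for all $(a,b)\in\mathcal{S}$ and $(x_{-\infty}^{-1},y_{-\infty}^{-1})\in\mathcal{S}_{-\infty}^{-1}$, $$P((a,b)\mid(x_{-\infty}^{-1},y_{-\infty}^{-1}))=\lambda_0P_0((a,b))+\sum_{k\ge1}\lambda_kP_k((a,b)\mid(x_{-k}^{-1},y_{-k}^{-1})).$$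 Let $(L_n)_{n\in\mathbb{Z}}$ be iid with $\mathbb{P}(L_n=k)=\lambda_k$, $k\in\mathbb N$. **The minimal $\bar d$-coupling.** Let $T_0=\sup\{z\le0: L_{z+m}\le m\ \forall m\ge0\}$ and, for $n\ge1$, $T_{-n}=\sup\{z<T_{-n+1}: L_{z+m}\le m\ \forall m\ge0\}$, $T_n=\inf\{z>T_{n-1}: L_{z+m}\le m\ \forall m\ge0\}$ (almost surely all $T_n$ are finite). Given $(L_n)_{n\in\mathbb Z}$, and hence $(T_j)_{j\in\mathbb Z}$, the strings $(\hat X_{T_j}^{T_{j+1}-1},\hat Y_{T_j}^{T_{j+1}-1})$, $j\in\mathbb{Z}$, are generated independently of each other, each as follows: (1) choose $(\hat X_{T_j},\hat Y_{T_j})\in\mathcal{S}$ with law $P_0$; (2) successively for $n=T_j+1,\dots,T_{j+1}-1$, choose $(\hat X_n,\hat Y_n)\in\mathcal{S}$ with law $P_{L_n}(\cdot\mid(\hat X_{n-L_n}^{n-1},\hat Y_{n-L_n}^{n-1}))$ (law $P_0$ if $L_n=0$); here $n-L_n\ge T_j$. The minimal $\bar d$-coupling is the concatenation $(\hat X_j,\hat Y_j)_{j\in\mathbb{Z}}$. **Perfect simulation algorithm** (input: integers $m\le n$; output: $(\tilde X_m^n,\tilde Y_m^n)$ and $T[m,n]$). Sequentially choose the iid variables $L_s$, $s=n,n-1,\dots$, each with law $(\lambda_k)$ and each sampled only once; for $t=m,m-1,m-2,\dots$ check whether $L_s\le s-t$ for all $s=t,\dots,n$, and stop at the first $t$ with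 this property, which is $T[m,n]$. Then, for $s=T[m,n],T[m,n]+1,\dots,n$ successively, choose $(\tilde X_s,\tilde Y_s)$ with law $P_{L_s}(\cdot\mid(\tilde X_{s-L_s}^{s-1},\tilde Y_{s-L_s}^{s-1}))$ (law $P_0$ if $L_s=0$; in particular $L_{T[m,n]}=0$). Return $(\tilde X_m^n,\tilde Y_m^n)$ and $T[m,n]$. *)

theory Defs
  imports "HOL-Probability.Probability"
begin

text \<open>The alphabet \<open>{0, 1}\<close> is \<open>bool\<close> with \<open>False = 0\<close> and \<open>True = 1\<close>. A past
  \<open>(x\<^sub>i)\<close>, \<open>i \<le> -1\<close>, is the function \<open>nat \<Rightarrow> 'a\<close> whose value at \<open>j\<close> is the symbol at time \<open>-1 - j\<close>,
  and a string indexed by \<open>-k, \<dots>, -1\<close> is the list of length \<open>k\<close> in the same order, most recent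
  symbol first. The pointwise order on pasts is the library order on functions.\<close>

type_synonym 'a past = "nat \<Rightarrow> 'a"
type_synonym sym = "bool \<times> bool"

definition past :: "(int \<Rightarrow> 'a) \<Rightarrow> int \<Rightarrow> 'a past" where
  "past z n = (\<lambda>j. z (n - 1 - int j))"

definition recent :: "nat \<Rightarrow> 'a past \<Rightarrow> 'a list" where
  "recent k x = map x [0..<k]"

abbreviation seqs :: "('i \<Rightarrow> 'a) measure" where
  "seqs \<equiv> PiM UNIV (\<lambda>_. count_space UNIV)"


section \<open>Chains of infinite order\<close>

definition stationary_chain ::
    "'w measure \<Rightarrow> (int \<Rightarrow> 'w \<Rightarrow> bool) \<Rightarrow> (bool past \<Rightarrow> bool pmf) \<Rightarrow> bool" where
  "stationary_chain M X p \<longleftrightarrow>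
     prob_space M \<and>
     (\<forall>n. X n \<in> measurable M (count_space UNIV)) \<and>
     (\<forall>k. distr M seqs (\<lambda>\<omega> n. X (n + k) \<omega>) = distr M seqs (\<lambda>\<omega> n. X n \<omega>)) \<and>
     (\<forall>a. (\<lambda>x. pmf (p x) a) \<in> borel_measurable seqs) \<and>
     (\<forall>a. AE \<omega> in M.
        real_cond_exp M (vimage_algebra (space M) (\<lambda>\<omega>. past (\<lambda>n. X n \<omega>) 0) seqs)
          (indicator {\<omega> \<in> space M. X 0 \<omega> = a}) \<omega>
        = pmf (p (past (\<lambda>n. X n \<omega>) 0)) a)"

definition beta :: "(bool past \<Rightarrow> bool pmf) \<Rightarrow> nat \<Rightarrow> real" where
  "beta p k =
     (MAX a\<in>UNIV. Sup {\<bar>pmf (p x) a - pmf (p y) a\<bar> | x y. recent k x = recent k y})"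


section \<open>The coupled kernel and its decomposition\<close>

definition S :: "sym set" where
  "S = {(False, False), (False, True), (True, True)}"

definition S_pasts :: "sym past set" where
  "S_pasts = {w. \<forall>j. w j \<in> S}"

definition S_strings :: "nat \<Rightarrow> sym list set" where
  "S_strings k = {w. length w = k \<and> set w \<subseteq> S}"

text \<open>The value at \<open>(True, False)\<close>, which is not in \<^const>\<open>S\<close>, is irrelevant.\<close>

fun coupled_kernel ::
    "(bool past \<Rightarrow> bool pmf) \<Rightarrow> (bool past \<Rightarrow> bool pmf) \<Rightarrow> sym \<Rightarrow> sym past \<Rightarrow> real" where
  "coupled_kernel pX pY (True, True) w = pmf (pX (fst \<circ> w)) True"
| "coupled_kernel pX pY (False, False) w = pmf (pY (snd \<circ> w)) False"
| "coupled_kernel pX pY (False, True) w = pmf (pX (fst \<circ> w)) False - pmf (pY (snd \<circ> w)) False"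
| "coupled_kernel pX pY (True, False) w = 0"

text \<open>For \<open>k = 0\<close> the only string is \<open>[]\<close>, and the infimum in \<open>r\<close> is over all of \<^const>\<open>S_pasts\<close>.\<close>

definition r ::
    "(bool past \<Rightarrow> bool pmf) \<Rightarrow> (bool past \<Rightarrow> bool pmf) \<Rightarrow> nat \<Rightarrow> sym \<Rightarrow> sym list \<Rightarrow> real" where
  "r pX pY k s w = Inf {coupled_kernel pX pY s u | u. u \<in> S_pasts \<and> recent k u = w}"

definition alpha :: "(bool past \<Rightarrow> bool pmf) \<Rightarrow> (bool past \<Rightarrow> bool pmf) \<Rightarrow> nat \<Rightarrow> real" where
  "alpha pX pY k = Inf {\<Sum>s\<in>S. r pX pY k s w | w. w \<in> S_strings k}"

definition lam :: "(bool past \<Rightarrow> bool pmf) \<Rightarrow> (bool past \<Rightarrow> bool pmf) \<Rightarrow> nat \<Rightarrow> real" where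
  "lam pX pY k = (case k of 0 \<Rightarrow> alpha pX pY 0 | Suc j \<Rightarrow> alpha pX pY (Suc j) - alpha pX pY j)"

definition decomposition ::
    "(bool past \<Rightarrow> bool pmf) \<Rightarrow> (bool past \<Rightarrow> bool pmf) \<Rightarrow>
     sym pmf \<Rightarrow> (nat \<Rightarrow> sym list \<Rightarrow> sym pmf) \<Rightarrow> bool" where
  "decomposition pX pY P0 Pk \<longleftrightarrow>
     set_pmf P0 \<subseteq> S \<and>
     (\<forall>k\<ge>1. \<forall>w\<in>S_strings k. set_pmf (Pk k w) \<subseteq> S) \<and>
     (\<forall>s\<in>S. \<forall>w\<in>S_pasts.
        (\<lambda>j. lam pX pY (Suc j) * pmf (Pk (Suc j) (recent (Suc j) w)) s)
          sums (coupled_kernel pX pY s w - lam pX pY 0 * pmf P0 s))"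


section \<open>Generating symbols from given context lengths\<close>

definition draw :: "sym pmf \<Rightarrow> (nat \<Rightarrow> sym list \<Rightarrow> sym pmf) \<Rightarrow> nat \<Rightarrow> sym list \<Rightarrow> sym pmf" where
  "draw P0 Pk l h = (if l = 0 then P0 else Pk l (take l h))"

text \<open>\<open>generate P0 Pk ls h\<close> extends the history \<open>h\<close> (most recent symbol first) by one symbol for
  each of the context lengths in \<open>ls\<close>, which are listed in chronological order.\<close>

primrec generate ::
    "sym pmf \<Rightarrow> (nat \<Rightarrow> sym list \<Rightarrow> sym pmf) \<Rightarrow> nat list \<Rightarrow> sym list \<Rightarrow> sym list pmf" where
  "generate P0 Pk [] h = return_pmf h"
| "generate P0 Pk (l # ls) h = bind_pmf (draw P0 Pk l h) (\<lambda>z. generate P0 Pk ls (z # h))"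


section \<open>The minimal d-bar coupling\<close>

definition regen :: "(int \<Rightarrow> nat) \<Rightarrow> int \<Rightarrow> bool" where
  "regen l z \<longleftrightarrow> (\<forall>m. l (z + int m) \<le> m)"

text \<open>\<open>Sup\<close> and \<open>Inf\<close> on \<open>int\<close> are only meaningful for nonempty sets bounded on the relevant side.
  Hence the times below are the intended ones if the set of regeneration times is unbounded in both
  directions; other \<open>l\<close> form a null event and their values do not matter.\<close>

primrec T_up :: "(int \<Rightarrow> nat) \<Rightarrow> nat \<Rightarrow> int" where
  "T_up l 0 = Sup {z. z \<le> 0 \<and> regen l z}"
| "T_up l (Suc n) = Inf {z. z > T_up l n \<and> regen l z}"

primrec T_down :: "(int \<Rightarrow> nat) \<Rightarrow> nat \<Rightarrow> int" where
  "T_down l 0 = Sup {z. z \<le> 0 \<and> regen l z}"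
| "T_down l (Suc n) = Sup {z. z < T_down l n \<and> regen l z}"

definition T :: "(int \<Rightarrow> nat) \<Rightarrow> int \<Rightarrow> int" where
  "T l j = (if 0 \<le> j then T_up l (nat j) else T_down l (nat (- j)))"

definition block_law ::
    "sym pmf \<Rightarrow> (nat \<Rightarrow> sym list \<Rightarrow> sym pmf) \<Rightarrow> (int \<Rightarrow> nat) \<Rightarrow> int \<Rightarrow> sym list pmf" where
  "block_law P0 Pk l j =
     map_pmf rev
       (bind_pmf P0 (\<lambda>z. generate P0 Pk (map l [T l j + 1 .. T l (j + 1) - 1]) [z]))"

definition concat_blocks :: "(int \<Rightarrow> int) \<Rightarrow> (int \<Rightarrow> 'a list) \<Rightarrow> int \<Rightarrow> 'a" where
  "concat_blocks t b i =
     (let j = (THE j. t j \<le> i \<and> i < t (j + 1)) in b j ! nat (i - t j))"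

text \<open>The law of the coupling given that the context lengths are \<open>l\<close>.\<close>

definition coupling_given ::
    "sym pmf \<Rightarrow> (nat \<Rightarrow> sym list \<Rightarrow> sym pmf) \<Rightarrow> (int \<Rightarrow> nat) \<Rightarrow> (int \<Rightarrow> sym) measure" where
  "coupling_given P0 Pk l =
     distr (PiM UNIV (\<lambda>j. measure_pmf (block_law P0 Pk l j))) seqs (concat_blocks (T l))"

definition minimal_dbar_coupling ::
    "sym pmf \<Rightarrow> (nat \<Rightarrow> sym list \<Rightarrow> sym pmf) \<Rightarrow>
     'w measure \<Rightarrow> (int \<Rightarrow> 'w \<Rightarrow> nat) \<Rightarrow> (int \<Rightarrow> 'w \<Rightarrow> sym) \<Rightarrow> bool" where
  "minimal_dbar_coupling P0 Pk M L Z \<longleftrightarrow>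
     (\<forall>i. Z i \<in> measurable M (count_space UNIV)) \<and>
     (\<forall>A\<in>sets seqs. \<forall>B\<in>sets seqs.
        emeasure M {\<omega> \<in> space M. (\<lambda>i. L i \<omega>) \<in> A \<and> (\<lambda>i. Z i \<omega>) \<in> B}
        = (\<integral>\<^sup>+\<omega>. indicator A (\<lambda>i. L i \<omega>) *
                emeasure (coupling_given P0 Pk (\<lambda>i. L i \<omega>)) B \<partial>M))"


section \<open>Perfect simulation\<close>

text \<open>\<open>ereal\<close>-valued, so that the supremum of the empty set is \<open>-\<infinity>\<close>.\<close>

definition T_window :: "(int \<Rightarrow> nat) \<Rightarrow> int \<Rightarrow> int \<Rightarrow> ereal" where
  "T_window l m n =
     Sup ((\<lambda>t. ereal (real_of_int t)) ` {t. t \<le> m \<and> (\<forall>s\<in>{t..n}. int (l s) \<le> s - t)})"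

text \<open>In a call \<open>search \<Lambda> m t ls\<close> the list \<open>ls\<close> holds the values already sampled at the times
  \<open>t, t + 1, \<dots>, n\<close>, so \<open>ls ! i\<close> is the one at time \<open>s = t + i\<close>. In the \<open>spmf\<close> monad the missing
  mass is the probability that the recursion does not terminate.\<close>

partial_function (spmf) search ::
    "nat pmf \<Rightarrow> int \<Rightarrow> int \<Rightarrow> nat list \<Rightarrow> (int \<times> nat list) spmf" where
  "search \<Lambda> m t ls =
     (if t \<le> m \<and> (\<forall>i<length ls. ls ! i \<le> i) then return_spmf (t, ls)
      else bind_spmf (spmf_of_pmf \<Lambda>) (\<lambda>l. search \<Lambda> m (t - 1) (l # ls)))"

definition perfect_simulation ::
    "nat pmf \<Rightarrow> sym pmf \<Rightarrow> (nat \<Rightarrow> sym list \<Rightarrow> sym pmf) \<Rightarrow> int \<Rightarrow> int \<Rightarrow>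
     (sym list \<times> int) spmf" where
  "perfect_simulation \<Lambda> P0 Pk m n =
     bind_spmf (search \<Lambda> m (n + 1) []) (\<lambda>(t, ls).
       bind_spmf (spmf_of_pmf (generate P0 Pk ls [])) (\<lambda>h.
         return_spmf (drop (nat (m - t)) (rev h), t)))"

end

theory Submission
  imports Defs
begin

text \<open>The \<open>\<lambda>\<^sub>k\<close> are the increments of the \<open>\<alpha>\<^sub>k\<close>, so \<open>\<alpha>\<^sub>k = P(L\<^sub>n \<le> k)\<close>, and every \<open>t\<close> satisfies
  \<open>L\<^sub>s \<le> s - t\<close> for all \<open>s \<ge> t\<close> with probability \<open>\<Prod>\<^sub>k \<alpha>\<^sub>k > 0\<close>. By Kolmogorov's zero-one law such
  regeneration times almost surely exist arbitrarily far in both directions, which gives (a) and (c).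
  Symbols generated from a time \<open>u\<close> with \<open>L\<^sub>s \<le> s - u\<close> for \<open>u \<le> s \<le> n\<close> do not look at the symbols
  before \<open>u\<close>. So, given \<open>L\<close>, the window of the coupling has the same law whether the generation
  starts at a regeneration time before \<open>m\<close> or at the later time \<open>T[m,n]\<close>, and the latter is what the
  algorithm does.\<close>

section \<open>Generating symbols\<close>

lemma generate_append:
  "generate P0 Pk (ls @ ls') h = bind_pmf (generate P0 Pk ls h) (generate P0 Pk ls')"
  by (induction ls arbitrary: h) (simp_all add: bind_return_pmf bind_assoc_pmf)

text \<open>At step \<open>i\<close> there are \<open>i + length h\<close> symbols in front of
  \<open>h'\<close>, so a context of at most that length never reaches into
  \<open>h'\<close>.\<close>

lemma generate_history:
  assumes "\<forall>i<length ls. ls ! i \<le> i + length h"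
  shows "generate P0 Pk ls (h @ h') = map_pmf (\<lambda>x. x @ h') (generate P0 Pk ls h)"
  using assms
proof (induction ls arbitrary: h)
  case (Cons l ls)
  from Cons.prems have "draw P0 Pk l (h @ h') = draw P0 Pk l h"
    by (auto simp: draw_def)
  moreover have "generate P0 Pk ls ((z # h) @ h') = map_pmf (\<lambda>x. x @ h') (generate P0 Pk ls (z # h))" for z
    using Cons.prems by (intro Cons.IH) auto
  ultimately show ?case
    by (simp add: map_bind_pmf)
qed simp

lemma generate_fresh:
  assumes "\<forall>i<length ls. ls ! i \<le> i"
  shows "generate P0 Pk ls h = map_pmf (\<lambda>x. x @ h) (generate P0 Pk ls [])"
  using generate_history[of ls "[]" P0 Pk h] assms by simp

lemma set_pmf_generateD:
  "x \<in> set_pmf (generate P0 Pk ls h) \<Longrightarrow> \<exists>y. x = y @ h \<and> length y = length ls"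
proof (induction ls arbitrary: h)
  case (Cons l ls)
  then obtain z where "x \<in> set_pmf (generate P0 Pk ls (z # h))"
    by auto
  from Cons.IH[OF this] show ?case
    by (metis append.assoc append_Cons append_Nil length_append_singleton length_Cons)
qed simp

lemma length_generate: "x \<in> set_pmf (generate P0 Pk ls []) \<Longrightarrow> length x = length ls"
  using set_pmf_generateD by fastforce

text \<open>Finite-horizon form of \<open>regen\<close>: it involves only the lengths at times
  \<open>t..n\<close>, which the algorithm has sampled by the time it tests
  \<open>t\<close>.\<close>

definition regen_upto :: "(int \<Rightarrow> nat) \<Rightarrow> int \<Rightarrow> int \<Rightarrow> bool" where
  "regen_upto l n t \<longleftrightarrow> (\<forall>s\<in>{t..n}. int (l s) \<le> s - t)"

text \<open>Passes to list positions, the form of the premise of \<open>generate_fresh\<close> and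
  of the stopping test in \<open>search\<close>.\<close>

lemma regen_upto_iff_nth: "regen_upto l n t \<longleftrightarrow> (\<forall>i<length [t..n]. map l [t..n] ! i \<le> i)"
proof
  assume *: "regen_upto l n t"
  show "\<forall>i<length [t..n]. map l [t..n] ! i \<le> i"
  proof (intro allI impI)
    fix i assume "i < length [t..n]"
    with *[unfolded regen_upto_def, rule_format, of "t + int i"]
    show "map l [t..n] ! i \<le> i"
      by simp
  qed
next
  assume *: "\<forall>i<length [t..n]. map l [t..n] ! i \<le> i"
  show "regen_upto l n t"
    unfolding regen_upto_def
  proof
    fix s assume "s \<in> {t..n}"
    with *[rule_format, of "nat (s - t)"] show "int (l s) \<le> s - t"
      by auto
  qed
qed

lemma regen_iff: "regen l z \<longleftrightarrow> (\<forall>s\<ge>z. int (l s) \<le> s - z)"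
proof safe
  fix s assume "regen l z" "s \<ge> z"
  from this(1)[unfolded regen_def, rule_format, of "nat (s - z)"] this(2)
  show "int (l s) \<le> s - z"
    by (simp add: nat_le_iff)
next
  assume *: "\<forall>s\<ge>z. int (l s) \<le> s - z"
  show "regen l z"
    unfolding regen_def
  proof
    fix k show "l (z + int k) \<le> k"
      using *[rule_format, of "z + int k"] by simp
  qed
qed

lemma regen_upto_altdef: "regen_upto l n t \<longleftrightarrow> (\<forall>s\<in>{t..n}. l s \<in> {..nat (s - t)})"
proof -
  have "int (l s) \<le> s - t \<longleftrightarrow> l s \<le> nat (s - t)" if "s \<ge> t" for s
    using that by linarith
  then show ?thesis by (simp add: regen_upto_def)
qed

lemma regen_imp_regen_upto: "regen l z \<Longrightarrow> regen_upto l n z"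
  by (auto simp: regen_iff regen_upto_def)

text \<open>\<open>ls\<close> is meant to hold the lengths at times \<open>t..n\<close>. Generation
  starts from an empty history at \<open>t\<close>, and the \<open>m - t\<close> oldest symbols
  precede the window.\<close>

definition window_law ::
    "sym pmf \<Rightarrow> (nat \<Rightarrow> sym list \<Rightarrow> sym pmf) \<Rightarrow> int \<Rightarrow> int \<Rightarrow> nat list \<Rightarrow> sym list pmf" where
  "window_law P0 Pk m t ls = map_pmf (\<lambda>h. drop (nat (m - t)) (rev h)) (generate P0 Pk ls [])"

text \<open>From \<open>u\<close> on no symbol looks before \<open>u\<close>, so the symbols at
  times \<open>t..u-1\<close> only lengthen the initial segment that is dropped and can be summed
  out.\<close>

lemma window_law_eq:
  assumes "t \<le> u" "u \<le> m" "m \<le> n" and u: "regen_upto l n u"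
  shows "window_law P0 Pk m t (map l [t..n]) = window_law P0 Pk m u (map l [u..n])"
proof -
  let ?G = "generate P0 Pk (map l [t..u-1]) []" and ?H = "generate P0 Pk (map l [u..n]) []"
  have fresh: "generate P0 Pk (map l [u..n]) h = map_pmf (\<lambda>x. x @ h) ?H" for h
    using u by (intro generate_fresh) (simp add: regen_upto_iff_nth)
  have "generate P0 Pk (map l [t..n]) [] = bind_pmf ?G (generate P0 Pk (map l [u..n]))"
    using assms by (simp add: generate_append upto_split1[of t u n])
  then have "window_law P0 Pk m t (map l [t..n])
    = bind_pmf ?G (\<lambda>h. map_pmf (\<lambda>h. drop (nat (m - t)) (rev h)) (generate P0 Pk (map l [u..n]) h))"
    by (simp add: window_law_def map_bind_pmf)
  also have "\<dots> = bind_pmf ?G (\<lambda>_. window_law P0 Pk m u (map l [u..n]))"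
  proof (intro bind_pmf_cong refl)
    fix h assume "h \<in> set_pmf ?G"
    then have "length h = nat (u - t)"
      by (auto dest: length_generate)
    moreover have "nat (m - t) = nat (u - t) + nat (m - u)"
      using assms by simp
    ultimately have "drop (nat (m - t)) (rev (x @ h)) = drop (nat (m - u)) (rev x)" for x
      by simp
    then show "map_pmf (\<lambda>h. drop (nat (m - t)) (rev h)) (generate P0 Pk (map l [u..n]) h)
      = window_law P0 Pk m u (map l [u..n])"
      by (subst fresh) (simp add: window_law_def pmf.map_comp o_def)
  qed
  finally show ?thesis
    by simp
qed

section \<open>Regeneration times\<close>

lemma cSup_in_int:
  fixes X :: "int set"
  assumes "X \<noteq> {}" "bdd_above X"
  shows "Sup X \<in> X"
proof -
  obtain x where "x \<in> X" "Sup X - 1 < x"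
    using less_cSupE[of "Sup X - 1" X] assms by auto
  with cSup_upper[OF \<open>x \<in> X\<close> assms(2)] have "x = Sup X" by simp
  with \<open>x \<in> X\<close> show ?thesis by simp
qed

lemma cInf_in_int:
  fixes X :: "int set"
  assumes "X \<noteq> {}" "bdd_below X"
  shows "Inf X \<in> X"
proof -
  obtain x where "x \<in> X" "x < Inf X + 1"
    using cInf_lessD[of X "Inf X + 1"] assms by auto
  with cInf_lower[OF \<open>x \<in> X\<close> assms(2)] have "x = Inf X" by simp
  with \<open>x \<in> X\<close> show ?thesis by simp
qed

text \<open>On this event, shown to be almost sure in \<open>AE_recurrent\<close>, the sets in
  \<open>T_up\<close> and \<open>T_down\<close> are nonempty and bounded on the relevant side, so
  their \<open>Sup\<close> and \<open>Inf\<close> are attained.\<close>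

definition recurrent :: "(int \<Rightarrow> nat) \<Rightarrow> bool" where
  "recurrent l \<longleftrightarrow> (\<forall>K. (\<exists>z\<ge>K. regen l z) \<and> (\<exists>z\<le>K. regen l z))"

context
  fixes l :: "int \<Rightarrow> nat"
  assumes rec: "recurrent l"
begin

lemma Sup_regen:
  shows "Sup {z. z \<le> K \<and> regen l z} \<le> K" "regen l (Sup {z. z \<le> K \<and> regen l z})"
proof -
  have "Sup {z. z \<le> K \<and> regen l z} \<in> {z. z \<le> K \<and> regen l z}"
    using rec by (intro cSup_in_int) (auto simp: recurrent_def bdd_above_def)
  then show "Sup {z. z \<le> K \<and> regen l z} \<le> K" "regen l (Sup {z. z \<le> K \<and> regen l z})"
    by auto
qed

lemma Inf_regen:
  shows "Inf {z. z > K \<and> regen l z} > K" "regen l (Inf {z. z > K \<and> regen l z})"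
proof -
  have "Inf {z. z > K \<and> regen l z} \<in> {z. z > K \<and> regen l z}"
  proof (rule cInf_in_int)
    from rec obtain z where "z \<ge> K + 1" "regen l z" by (auto simp: recurrent_def)
    then show "{z. z > K \<and> regen l z} \<noteq> {}" by (auto intro!: exI[of _ z])
    show "bdd_below {z. z > K \<and> regen l z}" by (auto simp: bdd_below_def intro!: exI[of _ K])
  qed
  then show "Inf {z. z > K \<and> regen l z} > K" "regen l (Inf {z. z > K \<and> regen l z})"
    by auto
qed

lemma regen_T: "regen l (T l j)"
proof -
  have "regen l (T_up l k)" for k
    by (cases k) (auto intro: Sup_regen Inf_regen)
  moreover have "regen l (T_down l k)" for k
    using Sup_regen(2)[of "T_down l j - 1" for j]
    by (cases k) (auto intro: Sup_regen)
  ultimately show ?thesis by (simp add: T_def)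
qed

lemma T_less_Suc: "T l j < T l (j + 1)"
proof (cases "0 \<le> j")
  case True
  then have "nat (j + 1) = Suc (nat j)" by simp
  with True Inf_regen(1)[of "T_up l (nat j)"] show ?thesis by (simp add: T_def)
next
  case False
  then have "nat (- j) = Suc (nat (- (j + 1)))" by simp
  \<comment> \<open>At \<open>j = -1\<close> the step crosses from \<open>T_down\<close> to
    \<open>T_up\<close>, which have the same value at index 0.\<close>
  with False Sup_regen(1)[of "T_down l (nat (- (j + 1))) - 1"] show ?thesis
    by (cases "j = -1") (auto simp: T_def)
qed

lemma T_strict_mono: "strict_mono (T l)"
proof (rule strict_monoI)
  fix i j :: int assume "i < j"
  then show "T l i < T l j"
  proof (induction rule: int_gr_induct)
    case base show ?case by (rule T_less_Suc)
  next
    case (step k) with T_less_Suc[of k] show ?case by simp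
  qed
qed

lemma T_unbounded: "\<exists>j. T l j \<le> i" "\<exists>j. i < T l j"
proof -
  have *: "T l j + int k \<le> T l (j + int k)" for j k
  proof (induction k)
    case (Suc k)
    with T_less_Suc[of "j + int k"] show ?case by (simp add: algebra_simps)
  qed simp
  show "\<exists>j. T l j \<le> i"
    using *[of "- int (nat (T l 0 - i))" "nat (T l 0 - i)"]
    by (intro exI[of _ "- int (nat (T l 0 - i))"]) auto
  show "\<exists>j. i < T l j"
    using *[of 0 "nat (i - T l 0 + 1)"]
    by (intro exI[of _ "int (nat (i - T l 0 + 1))"]) auto
qed

text \<open>Gives the description \<open>THE j\<close> in \<open>concat_blocks\<close> its meaning.
  Existence climbs from some \<open>T l a\<close> not above \<open>i\<close> to some
  \<open>T l b\<close> beyond \<open>i\<close>; uniqueness is strict monotonicity.\<close>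

lemma T_block_unique: "\<exists>!j. T l j \<le> i \<and> i < T l (j + 1)"
proof (rule ex_ex1I)
  obtain a where a: "T l a \<le> i" using T_unbounded by blast
  obtain b where b: "i < T l b" using T_unbounded by blast
  have "a < b" using a b strict_mono_less[OF T_strict_mono] by (meson le_less_trans)
  then have "\<exists>j. T l j \<le> i \<and> i < T l (j + 1)"
    using b
  proof (induction rule: int_gr_induct)
    case base with a show ?case by blast
  next
    case (step k) then show ?case by (cases "i < T l k") (auto simp: not_less)
  qed
  then show "\<exists>j. T l j \<le> i \<and> i < T l (j + 1)" .
next
  fix j k assume "T l j \<le> i \<and> i < T l (j + 1)" "T l k \<le> i \<and> i < T l (k + 1)"
  then have "T l j < T l (k + 1)" "T l k < T l (j + 1)" by auto
  then show "j = k" by (simp add: strict_mono_less[OF T_strict_mono])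
qed

text \<open>The context length at a regeneration time is 0, so the initial draw from
  \<open>P0\<close> is itself a step of \<open>generate\<close>.\<close>

lemma block_law_eq:
  "block_law P0 Pk l j = map_pmf rev (generate P0 Pk (map l [T l j..T l (j + 1) - 1]) [])"
proof -
  have "l (T l j) = 0"
    using regen_T[of j, unfolded regen_def, rule_format, of 0] by simp
  moreover have "[T l j..T l (j + 1) - 1] = T l j # [T l j + 1..T l (j + 1) - 1]"
    using T_less_Suc[of j] by (intro upto_rec1) simp
  ultimately show ?thesis
    by (simp add: block_law_def draw_def)
qed

end

section \<open>Concatenating independent blocks\<close>

text \<open>Finite product of laws as a law on lists; \<open>distr_PiM_list\<close> identifies it
  with a marginal of the infinite product.\<close>

primrec list_pmf :: "('i \<Rightarrow> 'a pmf) \<Rightarrow> 'i list \<Rightarrow> 'a list pmf" where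
  "list_pmf p [] = return_pmf []"
| "list_pmf p (j # js) = bind_pmf (p j) (\<lambda>x. map_pmf ((#) x) (list_pmf p js))"

lemma pmf_list_pmf:
  "pmf (list_pmf p js) vs =
    (if length vs = length js then \<Prod>i<length js. pmf (p (js ! i)) (vs ! i) else 0)"
proof (induction js arbitrary: vs)
  case Nil
  then show ?case by (simp add: pmf_return)
next
  case (Cons j js)
  show ?case
  proof (cases vs)
    case Nil
    have "[] \<notin> set_pmf (list_pmf p (j # js))" by auto
    with Nil show ?thesis by (simp add: set_pmf_iff del: list_pmf.simps)
  next
    case (Cons v vs')
    have "pmf (map_pmf ((#) x) (list_pmf p js)) (v # vs')
        = indicator {v} x * pmf (list_pmf p js) vs'" for x
    proof (cases "x = v")
      case True
      then show ?thesis by (simp add: pmf_map_inj' inj_def)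
    next
      case False
      then have "v # vs' \<notin> set_pmf (map_pmf ((#) x) (list_pmf p js))" by auto
      with False show ?thesis by (simp add: set_pmf_iff del: set_map_pmf)
    qed
    then have "pmf (list_pmf p (j # js)) vs = pmf (p j) v * pmf (list_pmf p js) vs'"
      by (simp add: Cons pmf_bind measure_pmf_single)
    then show ?thesis
      unfolding Cons Cons.IH length_Cons prod.lessThan_Suc_shift by simp
  qed
qed

lemma measurable_map_list:
  fixes f :: "'i \<Rightarrow> 'w \<Rightarrow> 'a::countable"
  assumes "\<And>j. f j \<in> measurable M (count_space UNIV)"
  shows "(\<lambda>\<omega>. map (\<lambda>j. f j \<omega>) js) \<in> measurable M (count_space UNIV)"
proof (induction js)
  case (Cons j js)
  have "(\<lambda>\<omega>. x # map (\<lambda>j. f j \<omega>) js) \<in> measurable M (count_space UNIV)" for x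
    by (rule measurable_compose[OF Cons.IH]) simp
  then have "(\<lambda>\<omega>. f j \<omega> # map (\<lambda>j. f j \<omega>) js) \<in> measurable M (count_space UNIV)"
    by (rule measurable_compose_countable[OF _ assms])
  then show ?case by simp
qed simp

lemma sets_map_eq: "{z :: 'i \<Rightarrow> 'a::countable. map z js = v} \<in> sets seqs"
proof -
  have "(\<lambda>z :: 'i \<Rightarrow> 'a. map z js) \<in> measurable seqs (count_space UNIV)"
    by (rule measurable_map_list) simp
  from measurable_sets[OF this, of "{v}"] show ?thesis
    by (simp add: space_PiM vimage_def)
qed

text \<open>On a countable space it suffices to compare singletons, and the preimage of one is a
  cylinder. With a repeated index \<open>list_pmf\<close> would draw twice where the left side
  repeats one coordinate.\<close>

lemma distr_PiM_list:
  fixes p :: "'i \<Rightarrow> 'a::countable pmf"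
  assumes "distinct js"
  shows "distr (PiM UNIV (\<lambda>j. measure_pmf (p j))) (count_space UNIV) (\<lambda>b. map b js)
    = measure_pmf (list_pmf p js)"
proof -
  let ?P = "PiM UNIV (\<lambda>j. measure_pmf (p j))"
  interpret product_prob_space "\<lambda>j. measure_pmf (p j)" UNIV
    by unfold_locales
  have eq: "emeasure ?P {b \<in> space ?P. map b js = vs} = ennreal (pmf (list_pmf p js) vs)"
    and sets: "{b \<in> space ?P. map b js = vs} \<in> sets ?P" for vs
  proof -
    consider "length vs = length js" | "length vs \<noteq> length js" by blast
    then have "emeasure ?P {b \<in> space ?P. map b js = vs} = ennreal (pmf (list_pmf p js) vs)
      \<and> {b \<in> space ?P. map b js = vs} \<in> sets ?P"
    proof cases
      case 1
      define f where "f = (\<lambda>j. the (map_of (zip js vs) j))"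
      have f: "f (js ! i) = vs ! i" if "i < length js" for i
        using that 1 assms by (simp add: f_def map_of_zip_nth)
      have "map b js = vs \<longleftrightarrow> (\<forall>j\<in>set js. b j \<in> {f j})" for b
        unfolding list_eq_iff_nth_eq all_set_conv_all_nth using 1 f by auto
      then have *: "{b \<in> space ?P. map b js = vs} = {b \<in> space ?P. \<forall>j\<in>set js. b j \<in> {f j}}"
        by simp
      have "emeasure ?P {b \<in> space ?P. map b js = vs} = (\<Prod>j\<in>set js. ennreal (pmf (p j) (f j)))"
        unfolding * by (subst emeasure_PiM_Collect) (auto simp: emeasure_pmf_single)
      also have "\<dots> = (\<Prod>i<length js. ennreal (pmf (p (js ! i)) (vs ! i)))"
        using prod.reindex_bij_betw[OF bij_betw_nth[OF assms refl refl], of "\<lambda>j. ennreal (pmf (p j) (f j))"]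
        by (simp add: f)
      finally show ?thesis
        unfolding * using 1 by (auto simp: pmf_list_pmf prod_ennreal)
    next
      case 2
      then have *: "{b \<in> space ?P. map b js = vs} = {}" by auto
      show ?thesis unfolding * using 2 by (simp add: pmf_list_pmf)
    qed
    then show "emeasure ?P {b \<in> space ?P. map b js = vs} = ennreal (pmf (list_pmf p js) vs)"
      "{b \<in> space ?P. map b js = vs} \<in> sets ?P" by auto
  qed
  have meas: "(\<lambda>b. map b js) \<in> measurable ?P (count_space UNIV)"
    using sets by (subst measurable_count_space_eq2_countable) (auto simp: vimage_def Int_def conj_commute)
  show ?thesis
  proof (rule measure_eqI_countable[where A=UNIV])
    fix vs
    show "emeasure (distr ?P (count_space UNIV) (\<lambda>b. map b js)) {vs} = emeasure (list_pmf p js) {vs}"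
      using eq[of vs] meas
      by (simp add: emeasure_distr emeasure_pmf_single vimage_def Int_def conj_commute)
  qed auto
qed

lemma list_pmf_length:
  assumes "vs \<in> set_pmf (list_pmf p js)" shows "list_all2 (\<lambda>v j. v \<in> set_pmf (p j)) vs js"
  using assms by (induction js arbitrary: vs) auto

text \<open>Blocks of these lengths, laid end to end from time \<open>t a\<close>, put the symbol of
  time \<open>i\<close> at offset \<open>i - t a\<close>. This matches \<open>concat\<close> with
  the lookup in \<open>concat_blocks\<close>. The induction peels off the oldest block.\<close>

lemma nth_concat_blocks:
  fixes t :: "int \<Rightarrow> int"
  assumes "mono t" "\<And>k. k < length vs \<Longrightarrow> length (vs ! k) = nat (t (a + int k + 1) - t (a + int k))"
    and "k < length vs" "t (a + int k) \<le> i" "i < t (a + int k + 1)"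
  shows "concat vs ! nat (i - t a) = vs ! k ! nat (i - t (a + int k))"
  using assms(2-)
proof (induction vs arbitrary: a k)
  case (Cons v vs)
  have v: "length v = nat (t (a + 1) - t a)" using Cons.prems(1)[of 0] by simp
  have t: "t a \<le> t (a + 1)" using assms(1) by (simp add: mono_def)
  show ?case
  proof (cases k)
    case 0
    with Cons.prems v show ?thesis by (simp add: nth_append)
  next
    case (Suc k')
    have "concat vs ! nat (i - t (a + 1)) = vs ! k' ! nat (i - t (a + 1 + int k'))"
    proof (rule Cons.IH)
      fix q assume "q < length vs"
      then show "length (vs ! q) = nat (t (a + 1 + int q + 1) - t (a + 1 + int q))"
        using Cons.prems(1)[of "Suc q"] by (simp add: algebra_simps)
    qed (use Cons.prems Suc in \<open>simp_all add: algebra_simps\<close>)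
    moreover have "t (a + 1) \<le> t (a + int k)" using assms(1) Suc by (simp add: mono_def)
    then have "t (a + 1) \<le> i" using Cons.prems by simp
    then have "nat (i - t a) = length v + nat (i - t (a + 1))" using v t by simp
    ultimately show ?thesis using Suc by (simp add: algebra_simps)
  qed
qed simp

lemma length_concat_blocks:
  fixes t :: "int \<Rightarrow> int"
  assumes "mono t" "\<And>k. k < length vs \<Longrightarrow> length (vs ! k) = nat (t (a + int k + 1) - t (a + int k))"
  shows "length (concat vs) = nat (t (a + int (length vs)) - t a)"
  using assms(2-)
proof (induction vs arbitrary: a)
  case (Cons v vs)
  have v: "length v = nat (t (a + 1) - t a)" using Cons.prems(1)[of 0] by simp
  have "t a \<le> t (a + 1)" "t (a + 1) \<le> t (a + 1 + int (length vs))" using assms(1) by (simp_all add: mono_def)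
  moreover have "length (concat vs) = nat (t (a + 1 + int (length vs)) - t (a + 1))"
  proof (rule Cons.IH)
    fix q assume "q < length vs"
    then show "length (vs ! q) = nat (t (a + 1 + int q + 1) - t (a + 1 + int q))"
      using Cons.prems(1)[of "Suc q"] by (simp add: algebra_simps)
  qed
  ultimately show ?case using v by (simp add: algebra_simps)
qed simp

text \<open>Every \<open>T l j\<close> is a regeneration time, so one run of \<open>generate\<close>
  across several blocks ignores the history at each block boundary and splits into independent
  blocks. The induction prepends older blocks, starting from the empty range
  \<open>a = b + 1\<close>.\<close>

lemma list_pmf_block_law:
  assumes rec: "recurrent l" and "a \<le> b + 1"
  shows "map_pmf concat (list_pmf (block_law P0 Pk l) [a..b])
    = map_pmf rev (generate P0 Pk (map l [T l a..T l (b + 1) - 1]) [])"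
  using \<open>a \<le> b + 1\<close>
proof (induction rule: int_le_induct)
  case base
  then show ?case by simp
next
  case (step a)
  let ?A = "map l [T l (a - 1)..T l a - 1]" and ?B = "map l [T l a..T l (b + 1) - 1]"
  have T: "T l (a - 1) < T l a" "T l a \<le> T l (b + 1)"
    using T_less_Suc[OF rec, of "a - 1"] step.hyps strict_mono_less_eq[OF T_strict_mono[OF rec]] by auto
  have fresh: "generate P0 Pk ?B h = map_pmf (\<lambda>x. x @ h) (generate P0 Pk ?B [])" for h
    using regen_T[OF rec, of a, THEN regen_imp_regen_upto, of "T l (b + 1) - 1"]
    by (intro generate_fresh) (simp add: regen_upto_iff_nth)
  have "map l [T l (a - 1)..T l (b + 1) - 1] = ?A @ ?B"
    using T upto_split2[of "T l (a - 1)" "T l a - 1" "T l (b + 1) - 1"] by simp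
  then have "map_pmf rev (generate P0 Pk (map l [T l (a - 1)..T l (b + 1) - 1]) [])
     = bind_pmf (generate P0 Pk ?A []) (\<lambda>h. map_pmf (\<lambda>x. rev h @ rev x) (generate P0 Pk ?B []))"
    by (simp add: generate_append map_bind_pmf)
      (subst fresh, simp add: pmf.map_comp o_def)
  also have "\<dots> = bind_pmf (block_law P0 Pk l (a - 1))
      (\<lambda>x. map_pmf ((@) x) (map_pmf rev (generate P0 Pk ?B [])))"
    by (simp add: block_law_eq[OF rec] bind_map_pmf pmf.map_comp o_def)
  also have "\<dots> = bind_pmf (block_law P0 Pk l (a - 1))
      (\<lambda>x. map_pmf (\<lambda>vs. x @ concat vs) (list_pmf (block_law P0 Pk l) [a..b]))"
    unfolding step.IH[symmetric] by (simp add: pmf.map_comp o_def)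
  also have "\<dots> = map_pmf concat (list_pmf (block_law P0 Pk l) [a - 1..b])"
    using step.hyps upto_rec1[of "a - 1" b] by (simp add: map_bind_pmf pmf.map_comp o_def)
  finally show ?case ..
qed

text \<open>In chronological order later steps only append: the first \<open>k\<close> symbols are
  fixed after the first \<open>k\<close> steps, and the remaining steps integrate to one.\<close>

lemma take_generate:
  assumes "k = length ls"
  shows "map_pmf (\<lambda>x. take k (rev x)) (generate P0 Pk (ls @ ls') []) = map_pmf rev (generate P0 Pk ls [])"
proof -
  have "map_pmf (\<lambda>x. take k (rev x)) (generate P0 Pk ls' h) = return_pmf (rev h)"
    if "h \<in> set_pmf (generate P0 Pk ls [])" for h
  proof -
    have "take k (rev x) = rev h" if "x \<in> set_pmf (generate P0 Pk ls' h)" for x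
      using set_pmf_generateD[OF that] length_generate[OF \<open>h \<in> _\<close>] assms by auto
    then have "map_pmf (\<lambda>x. take k (rev x)) (generate P0 Pk ls' h) = map_pmf (\<lambda>_. rev h) (generate P0 Pk ls' h)"
      by (intro map_pmf_cong) auto
    then show ?thesis by simp
  qed
  then have "map_pmf (\<lambda>x. take k (rev x)) (generate P0 Pk (ls @ ls') [])
    = bind_pmf (generate P0 Pk ls []) (\<lambda>h. return_pmf (rev h))"
    unfolding generate_append map_bind_pmf by (intro bind_pmf_cong) auto
  then show ?thesis by (simp add: map_pmf_def)
qed

text \<open>The window is covered by the blocks with indices \<open>J m\<close> to
  \<open>J n\<close>, so only finitely many factors of the product matter. The time \<open>t\<close>
  obtained is the start of the block that contains \<open>m\<close>.\<close>

lemma coupling_given_window: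
  assumes rec: "recurrent l" and "m \<le> n"
  obtains t where "t \<le> m" "regen l t"
    "\<And>v. emeasure (coupling_given P0 Pk l) {z. map z [m..n] = v}
      = ennreal (pmf (window_law P0 Pk m t (map l [t..n])) v)"
proof -
  define J where "J i = (THE j. T l j \<le> i \<and> i < T l (j + 1))" for i
  have J: "T l (J i) \<le> i" "i < T l (J i + 1)" for i
    using theI'[OF T_block_unique[OF rec, of i]] by (auto simp: J_def)
  have J_mono: "J i \<le> J k" if "i \<le> k" for i k
  proof -
    have "T l (J i) < T l (J k + 1)" using J(1)[of i] J(2)[of k] that by simp
    then show ?thesis by (simp add: strict_mono_less[OF T_strict_mono[OF rec]])
  qed
  let ?a = "J m" and ?b = "J n"
  let ?p = "block_law P0 Pk l"
  let ?Q = "list_pmf ?p [?a..?b]"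
  let ?P = "PiM UNIV (\<lambda>j. measure_pmf (?p j))"
  let ?w = "\<lambda>xs. drop (nat (m - T l ?a)) (take (nat (n - T l ?a + 1)) xs)"
  \<comment> \<open>\<open>h\<close> looks each symbol up in its block as
    \<open>concat_blocks\<close> does, while \<open>?w\<close> cuts the window out of the
    concatenation. They agree once the block lengths are right, which holds on the support of
    \<open>?Q\<close>.\<close>
  define h where "h vs = map (\<lambda>i. (vs ! nat (J i - ?a)) ! nat (i - T l (J i))) [m..n]" for vs :: "sym list list"
  have h: "map (concat_blocks (T l) w) [m..n] = h (map w [?a..?b])" for w
    using J_mono by (auto simp: h_def concat_blocks_def Let_def J_def[symmetric])
  have mono: "mono (T l)" by (rule strict_mono_mono[OF T_strict_mono[OF rec]])
  have h_concat: "h vs = ?w (concat vs)" if vs: "vs \<in> set_pmf ?Q" for vs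
  proof -
    have all2: "list_all2 (\<lambda>v j. v \<in> set_pmf (?p j)) vs [?a..?b]"
      using vs by (rule list_pmf_length)
    then have len: "length vs = nat (?b - ?a + 1)" by (auto dest: list_all2_lengthD)
    have len': "length (vs ! k) = nat (T l (?a + int k + 1) - T l (?a + int k))" if "k < length vs" for k
    proof -
      have "vs ! k \<in> set_pmf (?p (?a + int k))"
        using list_all2_nthD[OF all2 that] that len by simp
      then show ?thesis by (auto simp: block_law_eq[OF rec] dest!: length_generate)
    qed
    have ab: "?a \<le> ?b" using J_mono \<open>m \<le> n\<close> .
    have lc: "length (concat vs) = nat (T l (?b + 1) - T l ?a)"
      using length_concat_blocks[OF mono len'] len ab by (simp add: algebra_simps)
    have "nat (n - T l ?a + 1) \<le> length (concat vs)" using J(2)[of n] by (simp add: lc)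
    show ?thesis
    proof (rule nth_equalityI)
      show "length (h vs) = length (?w (concat vs))"
        using J[of m] J[of n] \<open>m \<le> n\<close> by (simp add: h_def lc del: length_concat)
    next
      fix k assume "k < length (h vs)"
      then have k: "m + int k \<le> n" by (simp add: h_def)
      let ?i = "m + int k"
      have Ji: "?a \<le> J ?i" "J ?i \<le> ?b" using J_mono k by auto
      have "concat vs ! nat (?i - T l ?a) = vs ! nat (J ?i - ?a) ! nat (?i - T l (?a + int (nat (J ?i - ?a))))"
        using Ji J[of ?i] len by (intro nth_concat_blocks[OF mono len']) auto
      moreover have "nat (?i - T l ?a) = nat (m - T l ?a) + k" using J(1)[of m] by simp
      moreover have "?w (concat vs) ! k = concat vs ! (nat (m - T l ?a) + k)"
        using J(1)[of m] J(2)[of n] k lc by (subst nth_drop) auto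
      moreover have "[m..n] ! k = ?i" using k by (rule nth_upto)
      then have "h vs ! k = vs ! nat (J ?i - ?a) ! nat (?i - T l (J ?i))"
        using k by (simp add: h_def)
      ultimately show "h vs ! k = ?w (concat vs) ! k"
        using Ji by simp
    qed
  qed
  have "map_pmf h ?Q = map_pmf ?w (map_pmf concat ?Q)"
    unfolding pmf.map_comp o_def using h_concat by (intro map_pmf_cong refl) auto
  also have "\<dots> = map_pmf ?w (map_pmf rev (generate P0 Pk (map l [T l ?a..T l (?b + 1) - 1]) []))"
    using J_mono[OF \<open>m \<le> n\<close>] by (subst list_pmf_block_law[OF rec]) auto
  \<comment> \<open>Cut at \<open>n\<close>: the symbols of the last block that come after the
    window are removed by \<open>take_generate\<close>.\<close>
  also have "[T l ?a..T l (?b + 1) - 1] = [T l ?a..n] @ [n + 1..T l (?b + 1) - 1]"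
    using J[of m] J[of n] \<open>m \<le> n\<close> by (intro upto_split2) auto
  also have "map_pmf ?w (map_pmf rev (generate P0 Pk (map l ([T l ?a..n] @ [n + 1..T l (?b + 1) - 1])) []))
    = map_pmf (drop (nat (m - T l ?a))) (map_pmf (\<lambda>x. take (nat (n - T l ?a + 1)) (rev x))
        (generate P0 Pk (map l [T l ?a..n] @ map l [n + 1..T l (?b + 1) - 1]) []))"
    by (simp add: pmf.map_comp o_def)
  also have "\<dots> = window_law P0 Pk m (T l ?a) (map l [T l ?a..n])"
    by (subst take_generate) (simp_all add: window_law_def pmf.map_comp o_def)
  finally have law: "map_pmf h ?Q = window_law P0 Pk m (T l ?a) (map l [T l ?a..n])" .
  \<comment> \<open>For fixed \<open>l\<close> the block index \<open>J i\<close> is fixed, so each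
    coordinate depends on one block only.\<close>
  have cb: "concat_blocks (T l) \<in> measurable ?P seqs"
  proof (rule measurable_PiM_single')
    fix i :: int
    have "(\<lambda>w. w (J i)) \<in> measurable ?P (measure_pmf (?p (J i)))"
      by (rule measurable_component_singleton) simp
    then have "(\<lambda>w. w (J i) ! nat (i - T l (J i))) \<in> measurable ?P (count_space UNIV)"
      by (rule measurable_compose) simp
    then show "(\<lambda>w. concat_blocks (T l) w i) \<in> measurable ?P (count_space UNIV)"
      by (simp add: concat_blocks_def Let_def J_def)
  qed (auto simp: space_PiM)
  have map_js: "(\<lambda>w. map w js) \<in> measurable ?P (count_space UNIV)" for js
    by (rule measurable_map_list) (auto intro: measurable_compose[OF measurable_component_singleton])
  have "emeasure (coupling_given P0 Pk l) {z. map z [m..n] = v}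
      = ennreal (pmf (window_law P0 Pk m (T l ?a) (map l [T l ?a..n])) v)" for v
  proof -
    have "emeasure (coupling_given P0 Pk l) {z. map z [m..n] = v}
      = emeasure ?P {w \<in> space ?P. h (map w [?a..?b]) = v}"
      unfolding coupling_given_def emeasure_distr[OF cb sets_map_eq] by (simp add: vimage_def h Int_def conj_commute)
    also have "\<dots> = emeasure (distr ?P (count_space UNIV) (\<lambda>w. map w [?a..?b])) (h -` {v})"
      by (subst emeasure_distr[OF map_js]) (auto intro!: arg_cong2[where f=emeasure])
    also have "\<dots> = emeasure (map_pmf h ?Q) {v}"
      by (simp add: distr_PiM_list)
    finally show ?thesis by (simp add: law emeasure_pmf_single)
  qed
  with J(1)[of m] regen_T[OF rec, of ?a] show ?thesis using that by blast
qed

section \<open>A zero-one law for events occurring infinitely often\<close>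

text \<open>Serves to read the two-sided \<open>L\<close> as one-sided sequences, forwards and
  backwards in time. Finite products of events are carried back along \<open>f\<close>.\<close>

lemma (in prob_space) indep_vars_reindex_inj:
  assumes indep: "indep_vars M' X UNIV" and "inj f"
  shows "indep_vars (\<lambda>i. M' (f i)) (\<lambda>i. X (f i)) UNIV"
  unfolding indep_vars_def2
proof safe
  show "random_variable (M' (f i)) (X (f i))" for i
    using indep by (auto simp: indep_vars_def2)
  let ?F = "\<lambda>i. {X i -` A \<inter> space M | A. A \<in> sets (M' i)}"
  have F: "indep_sets ?F UNIV" using indep by (simp add: indep_vars_def2)
  show "indep_sets (\<lambda>i. ?F (f i)) UNIV"
  proof (rule indep_setsI)
    show "?F (f i) \<subseteq> events" for i
      using F by (simp add: indep_sets_def)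
  next
    fix A J assume J: "J \<noteq> {}" "J \<subseteq> UNIV" "finite J" "\<forall>j\<in>J. A j \<in> ?F (f j)"
    have inv: "inv f (f j) = j" for j using \<open>inj f\<close> by simp
    have "prob (\<Inter>i\<in>f ` J. A (inv f i)) = (\<Prod>i\<in>f ` J. prob (A (inv f i)))"
      using J by (intro indep_setsD[OF F]) (simp_all add: inv)
    then show "prob (\<Inter>j\<in>J. A j) = (\<Prod>j\<in>J. prob (A j))"
      using \<open>inj f\<close> by (simp add: inv prod.reindex inj_on_subset[of f UNIV])
  qed
qed

text \<open>By \<open>tail\<close>, the event that \<open>Q k\<close> holds infinitely often does
  not change when finitely many coordinates are altered, so it is a tail event and has probability 0
  or 1. The uniform bound \<open>c\<close> excludes 0.\<close>

lemma (in prob_space) AE_infinitely_often_0_1: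
  fixes X :: "nat \<Rightarrow> 'a \<Rightarrow> 'b" and Q :: "nat \<Rightarrow> (nat \<Rightarrow> 'b) \<Rightarrow> bool"
  assumes indep: "indep_vars (\<lambda>_. count_space UNIV) X UNIV"
    and Q: "\<And>k. {x. Q k x} \<in> sets seqs"
    and tail: "\<And>N x y. (\<And>i. i \<ge> N \<Longrightarrow> x i = y i) \<Longrightarrow> (\<exists>\<^sub>\<infinity>k. Q k x) \<Longrightarrow> (\<exists>\<^sub>\<infinity>k. Q k y)"
    and c: "0 < c" "\<And>k. c \<le> prob {\<omega> \<in> space M. Q k (\<lambda>i. X i \<omega>)}"
  shows "AE \<omega> in M. \<exists>\<^sub>\<infinity>k. Q k (\<lambda>i. X i \<omega>)"
proof -
  define A where "A i = sets (vimage_algebra (space M) (X i) (count_space UNIV))" for i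
  have X: "X i \<in> measurable M (count_space UNIV)" for i
    using indep by (simp add: indep_vars_def2)
  have A: "A i = {X i -` B \<inter> space M | B. B \<in> sets (count_space UNIV)}" for i
    by (simp add: A_def sets_vimage_algebra2)
  let ?E = "{\<omega> \<in> space M. \<exists>\<^sub>\<infinity>k. Q k (\<lambda>i. X i \<omega>)}"
  have "{x. \<exists>\<^sub>\<infinity>k. Q k x} = (\<Inter>N. \<Union>k\<in>{N..}. {x. Q k x})"
    by (auto simp: INFM_nat_le)
  then have Q_inf: "{x. \<exists>\<^sub>\<infinity>k. Q k x} \<in> sets seqs"
    using Q by auto
  have "?E \<in> sigma_sets (space M) (\<Union> (A ` {N..}))" for N
  proof -
    let ?G = "sigma (space M) (\<Union> (A ` {N..}))"
    have sub: "\<Union> (A ` {N..}) \<subseteq> Pow (space M)"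
      by (auto simp: A)
    \<comment> \<open>Freezing the first \<open>N\<close> coordinates at an arbitrary value makes
      the sequence measurable with respect to the later variables alone; by \<open>tail\<close> the
      event stays the same.\<close>
    let ?Y = "\<lambda>\<omega> i. if i < N then undefined else X i \<omega>"
    have "?Y \<in> measurable ?G seqs"
    proof (rule measurable_PiM_single')
      fix i
      have "X i \<in> measurable ?G (count_space UNIV)" if "i \<ge> N"
      proof (rule measurableI)
        fix B :: "'b set"
        have "X i -` B \<inter> space M \<in> A i" by (auto simp: A)
        then show "X i -` B \<inter> space ?G \<in> sets ?G"
          using that by (simp add: sub space_measure_of sets_measure_of) (meson UN_I atLeast_iff sigma_sets.Basic)
      qed simp
      then show "(\<lambda>\<omega>. ?Y \<omega> i) \<in> measurable ?G (count_space UNIV)"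
        by (cases "i < N") auto
    qed (auto simp: space_PiM)
    from measurable_sets[OF this Q_inf]
    have "{\<omega> \<in> space M. \<exists>\<^sub>\<infinity>k. Q k (?Y \<omega>)} \<in> sigma_sets (space M) (\<Union> (A ` {N..}))"
      by (simp add: sub space_measure_of sets_measure_of vimage_def Int_def conj_commute)
    moreover have "(\<exists>\<^sub>\<infinity>k. Q k (?Y \<omega>)) \<longleftrightarrow> (\<exists>\<^sub>\<infinity>k. Q k (\<lambda>i. X i \<omega>))" for \<omega>
      by (rule iffI; erule tail[of N, rotated]) auto
    ultimately show ?thesis by simp
  qed
  then have "?E \<in> tail_events A"
    by (auto simp: tail_events_def)
  moreover have "indep_sets A UNIV"
    unfolding A using indep by (simp add: indep_vars_def2)
  moreover have "sigma_algebra (space M) (A i)" for i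
    unfolding A_def using sets.sigma_algebra_axioms[of "vimage_algebra (space M) (X i) (count_space UNIV)"] by simp
  ultimately have "prob ?E = 0 \<or> prob ?E = 1"
    by (intro kolmogorov_0_1_law)
  moreover have "c \<le> prob ?E"
  proof -
    \<comment> \<open>\<open>?E\<close> is the decreasing limit of these events, and
      \<open>?D N\<close> contains the event of \<open>Q N\<close>, so each has probability at least
      \<open>c\<close>.\<close>
    let ?D = "\<lambda>N. {\<omega> \<in> space M. \<exists>k\<ge>N. Q k (\<lambda>i. X i \<omega>)}"
    have XX: "(\<lambda>\<omega> i. X i \<omega>) \<in> measurable M seqs"
      by (rule measurable_PiM_single') (auto simp: space_PiM X)
    have Q': "{\<omega> \<in> space M. Q k (\<lambda>i. X i \<omega>)} \<in> events" for k
      using measurable_sets[OF XX Q[of k]] by (simp add: vimage_def Int_def conj_commute)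
    have "?D N = (\<Union>k\<in>{N..}. {\<omega> \<in> space M. Q k (\<lambda>i. X i \<omega>)})" for N by auto
    then have D: "?D N \<in> events" for N using Q' by auto
    have "(\<lambda>N. prob (?D N)) \<longlonglongrightarrow> prob (\<Inter>N. ?D N)"
    proof (rule finite_Lim_measure_decseq)
      show "decseq ?D"
        unfolding decseq_def using order_trans by blast
    qed (use D in blast)
    moreover have "(\<Inter>N. ?D N) = ?E"
      by (auto simp: INFM_nat_le)
    moreover have "c \<le> prob (?D N)" for N
      using c(2)[of N] finite_measure_mono[OF _ D, of "{\<omega> \<in> space M. Q N (\<lambda>i. X i \<omega>)}" N] by force
    ultimately show ?thesis
      by (auto intro: LIMSEQ_le_const)
  qed
  ultimately have "prob ?E = 1" using c(1) by auto
  then show ?thesis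
    by (rule AE_prob_1[THEN AE_mp]) auto
qed

section \<open>Independent context lengths\<close>

text \<open>What the argument takes from the kernels: iid lengths and a positive lower bound for the
  partial products of their distribution function. These products are the probabilities of
  regenerating up to a finite horizon.\<close>

locale context_lengths = prob_space M for M :: "'w measure" +
  fixes L :: "int \<Rightarrow> 'w \<Rightarrow> nat" and \<Lambda> :: "nat pmf" and c :: real
  assumes indep: "indep_vars (\<lambda>_. count_space UNIV) L UNIV"
    and distr_L: "\<And>i. distr M (count_space UNIV) (L i) = measure_pmf \<Lambda>"
    and c_pos: "0 < c"
    and prod_ge: "\<And>n. c \<le> (\<Prod>k\<le>n. measure_pmf.prob \<Lambda> {..k})"
begin

abbreviation lengths :: "'w \<Rightarrow> int \<Rightarrow> nat" where
  "lengths \<omega> \<equiv> \<lambda>i. L i \<omega>"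

lemma measurable_L [measurable]: "L i \<in> measurable M (count_space UNIV)"
  using indep by (simp add: indep_vars_def2)

lemma sets_lengths:
  assumes "finite J"
  shows "{\<omega> \<in> space M. \<forall>s\<in>J. L s \<omega> \<in> B s} \<in> events"
proof -
  have "{\<omega> \<in> space M. L s \<omega> \<in> B s} \<in> events" for s
    using measurable_sets[OF measurable_L, of "B s" s] by (simp add: vimage_def Int_def conj_commute)
  with assms show ?thesis by (intro sets.sets_Collect_finite_All) auto
qed

lemma prob_lengths:
  assumes "finite J"
  shows "prob {\<omega> \<in> space M. \<forall>s\<in>J. L s \<omega> \<in> B s} = (\<Prod>s\<in>J. measure_pmf.prob \<Lambda> (B s))"
proof (cases "J = {}")
  case True
  then show ?thesis by (simp add: prob_space)
next
  case False
  have "prob (\<Inter>s\<in>J. L s -` B s \<inter> space M) = (\<Prod>s\<in>J. prob (L s -` B s \<inter> space M))"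
    using indep assms False unfolding indep_vars_def2 by (intro indep_setsD) auto
  also have "\<dots> = (\<Prod>s\<in>J. measure_pmf.prob \<Lambda> (B s))"
    by (intro prod.cong refl, subst distr_L[symmetric], subst measure_distr) auto
  also have "(\<Inter>s\<in>J. L s -` B s \<inter> space M) = {\<omega> \<in> space M. \<forall>s\<in>J. L s \<omega> \<in> B s}"
    using False by auto
  finally show ?thesis .
qed

lemma prob_regen_upto:
  assumes "t \<le> n"
  shows "c \<le> prob {\<omega> \<in> space M. regen_upto (lengths \<omega>) n t}"
proof -
  have "prob {\<omega> \<in> space M. regen_upto (lengths \<omega>) n t} = (\<Prod>s\<in>{t..n}. measure_pmf.prob \<Lambda> {..nat (s - t)})"
    unfolding regen_upto_altdef by (rule prob_lengths) simp
  also have "\<dots> = (\<Prod>k\<le>nat (n - t). measure_pmf.prob \<Lambda> {..k})"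
    by (rule prod.reindex_bij_witness[of _ "\<lambda>k. t + int k" "\<lambda>s. nat (s - t)"]) (use assms in auto)
  finally show ?thesis using prod_ge by simp
qed

lemma sets_regen_upto: "{\<omega> \<in> space M. regen_upto (lengths \<omega>) n t} \<in> events"
  unfolding regen_upto_altdef by (rule sets_lengths) simp

text \<open>Let the horizon in \<open>prob_regen_upto\<close> tend to infinity: the events decrease
  to regeneration at \<open>z\<close>.\<close>

lemma prob_regen: "c \<le> prob {\<omega> \<in> space M. regen (lengths \<omega>) z}"
proof -
  let ?D = "\<lambda>k. {\<omega> \<in> space M. regen_upto (lengths \<omega>) (z + int k) z}"
  have "(\<lambda>k. prob (?D k)) \<longlonglongrightarrow> prob (\<Inter>k. ?D k)"
    using sets_regen_upto by (intro finite_Lim_measure_decseq) (auto simp: decseq_def regen_upto_def)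
  moreover have "regen l z" if "\<And>k. regen_upto l (z + int k) z" for l
    unfolding regen_def
  proof
    fix k show "l (z + int k) \<le> k"
      using that[of k, unfolded regen_upto_def, rule_format, of "z + int k"] by simp
  qed
  then have "(\<Inter>k. ?D k) = {\<omega> \<in> space M. regen (lengths \<omega>) z}"
    by (auto intro: regen_imp_regen_upto)
  moreover have "c \<le> prob (?D k)" for k
    by (rule prob_regen_upto) simp
  ultimately show ?thesis
    by (auto intro: LIMSEQ_le_const)
qed

text \<open>Whether \<open>k\<close> is a regeneration time depends on the coordinates from
  \<open>k\<close> on, so altering the first \<open>N\<close> of them has no effect for
  \<open>k \<ge> N\<close> and the zero-one law applies.\<close>

lemma AE_regen_above: "AE \<omega> in M. \<forall>K. \<exists>z\<ge>K. regen (lengths \<omega>) z"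
proof -
  have "AE \<omega> in M. \<exists>\<^sub>\<infinity>k. \<forall>i. L (int (k + i)) \<omega> \<le> i"
  proof (rule AE_infinitely_often_0_1[where X = "\<lambda>i. L (int i)" and Q = "\<lambda>k x. \<forall>i. x (k + i) \<le> i" and c = c])
    show "indep_vars (\<lambda>_. count_space UNIV) (\<lambda>i. L (int i)) UNIV"
      by (rule indep_vars_reindex_inj[OF indep]) simp
    have "{x \<in> space seqs. \<forall>i. x (k + i) \<le> i} \<in> sets (seqs :: (nat \<Rightarrow> nat) measure)" for k
      by measurable
    then show "{x. \<forall>i. x (k + i) \<le> i} \<in> sets (seqs :: (nat \<Rightarrow> nat) measure)" for k
      by (simp add: space_PiM)
    show "c \<le> prob {\<omega> \<in> space M. \<forall>i. L (int (k + i)) \<omega> \<le> i}" for k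
      using prob_regen[of "int k"] by (simp add: regen_def)
  next
    fix N and x y :: "nat \<Rightarrow> nat"
    assume "\<And>i. i \<ge> N \<Longrightarrow> x i = y i" "\<exists>\<^sub>\<infinity>k. \<forall>i. x (k + i) \<le> i"
    then show "\<exists>\<^sub>\<infinity>k. \<forall>i. y (k + i) \<le> i"
      unfolding INFM_nat_le by (metis max.bounded_iff trans_le_add1)
  qed (rule c_pos)
  then show ?thesis
  proof eventually_elim
    fix \<omega> assume *: "\<exists>\<^sub>\<infinity>k. \<forall>i. L (int (k + i)) \<omega> \<le> i"
    show "\<forall>K. \<exists>z\<ge>K. regen (lengths \<omega>) z"
    proof
      fix K
      from * obtain k where "k \<ge> nat K" "\<forall>i. L (int (k + i)) \<omega> \<le> i"
        unfolding INFM_nat_le by blast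
      then show "\<exists>z\<ge>K. regen (lengths \<omega>) z"
        by (intro exI[of _ "int k"]) (auto simp: regen_def)
    qed
  qed
qed

text \<open>The zero-one law in reversed time, with \<open>k\<close> the distance from
  \<open>n\<close> back to the candidate \<open>t\<close> and \<open>i\<close> the distance back to
  \<open>s\<close>. The finite horizon \<open>n\<close> keeps the condition inside the one-sided
  sequence.\<close>

lemma AE_regen_upto_below: "AE \<omega> in M. \<forall>n K. \<exists>t\<le>K. regen_upto (lengths \<omega>) n t"
  unfolding AE_all_countable
proof (intro allI)
  fix n K :: int
  \<comment> \<open>The left side is \<open>l (n - i) \<le> k - i\<close>, rearranged to avoid
    truncated subtraction on \<open>nat\<close>.\<close>
  have eq: "(\<forall>i\<le>k. l (n - int i) + i \<le> k) \<longleftrightarrow> regen_upto l n (n - int k)" for l k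
  proof
    assume *: "\<forall>i\<le>k. l (n - int i) + i \<le> k"
    show "regen_upto l n (n - int k)"
      unfolding regen_upto_def
    proof
      fix s assume "s \<in> {n - int k..n}"
      then have s: "nat (n - s) \<le> k" "n - int (nat (n - s)) = s" by auto
      with *[rule_format, OF s(1)] show "int (l s) \<le> s - (n - int k)"
        by simp
    qed
  next
    assume *: "regen_upto l n (n - int k)"
    show "\<forall>i\<le>k. l (n - int i) + i \<le> k"
    proof (intro allI impI)
      fix i assume "i \<le> k"
      with *[unfolded regen_upto_def, rule_format, of "n - int i"] show "l (n - int i) + i \<le> k"
        by simp
    qed
  qed
  have "AE \<omega> in M. \<exists>\<^sub>\<infinity>k. \<forall>i\<le>k. L (n - int i) \<omega> + i \<le> k"
  proof (rule AE_infinitely_often_0_1[where X = "\<lambda>i. L (n - int i)" and Q = "\<lambda>k x. \<forall>i\<le>k. x i + i \<le> k" and c = c])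
    show "indep_vars (\<lambda>_. count_space UNIV) (\<lambda>i. L (n - int i)) UNIV"
      by (rule indep_vars_reindex_inj[OF indep]) (simp add: inj_def)
    have "{x \<in> space seqs. \<forall>i\<le>k. x i + i \<le> k} \<in> sets (seqs :: (nat \<Rightarrow> nat) measure)" for k
      by measurable
    then show "{x. \<forall>i\<le>k. x i + i \<le> k} \<in> sets (seqs :: (nat \<Rightarrow> nat) measure)" for k
      by (simp add: space_PiM)
    show "c \<le> prob {\<omega> \<in> space M. \<forall>i\<le>k. L (n - int i) \<omega> + i \<le> k}" for k
      using prob_regen_upto[of "n - int k" n] by (simp add: eq[symmetric])
  next
    fix N and x y :: "nat \<Rightarrow> nat"
    assume xy: "\<And>i. i \<ge> N \<Longrightarrow> x i = y i" and x: "\<exists>\<^sub>\<infinity>k. \<forall>i\<le>k. x i + i \<le> k"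
    show "\<exists>\<^sub>\<infinity>k. \<forall>i\<le>k. y i + i \<le> k"
      unfolding INFM_nat_le
    proof
      fix m
      \<comment> \<open>Altering the first \<open>N\<close> coordinates can only spoil small
        \<open>k\<close>: the sum bounds every altered \<open>y i + i\<close>, so a \<open>k\<close>
        beyond it satisfies the condition at these \<open>i\<close> as well.\<close>
      obtain k where k: "k \<ge> max m (\<Sum>i<N. y i + i)" "\<forall>i\<le>k. x i + i \<le> k"
        using x unfolding INFM_nat_le by blast
      have "y i + i \<le> k" if "i \<le> k" for i
      proof (cases "i < N")
        case True
        then have "y i + i \<le> (\<Sum>i<N. y i + i)" by (intro member_le_sum) auto
        with k show ?thesis by simp
      next
        case False
        from k(2) that have "x i + i \<le> k" by blast
        with False xy[of i] show ?thesis by simp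
      qed
      moreover have "m \<le> k" using k(1) by simp
      ultimately show "\<exists>k\<ge>m. \<forall>i\<le>k. y i + i \<le> k" by blast
    qed
  qed (rule c_pos)
  then show "AE \<omega> in M. \<exists>t\<le>K. regen_upto (lengths \<omega>) n t"
  proof eventually_elim
    fix \<omega> assume "\<exists>\<^sub>\<infinity>k. \<forall>i\<le>k. L (n - int i) \<omega> + i \<le> k"
    then obtain k where "k \<ge> nat (n - K)" "\<forall>i\<le>k. L (n - int i) \<omega> + i \<le> k"
      unfolding INFM_nat_le by blast
    then have "n - int k \<le> K" "regen_upto (lengths \<omega>) n (n - int k)"
      by (auto simp: eq[symmetric])
    then show "\<exists>t\<le>K. regen_upto (lengths \<omega>) n t" by blast
  qed
qed

text \<open>A time that regenerates up to a later regeneration time is itself a regeneration time.\<close>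

lemma AE_recurrent: "AE \<omega> in M. recurrent (lengths \<omega>)"
  using AE_regen_above AE_regen_upto_below
proof eventually_elim
  fix \<omega>
  assume above: "\<forall>K. \<exists>z\<ge>K. regen (lengths \<omega>) z"
    and below: "\<forall>n K. \<exists>t\<le>K. regen_upto (lengths \<omega>) n t"
  have "\<exists>z\<le>K. regen (lengths \<omega>) z" for K
  proof -
    obtain z where z: "regen (lengths \<omega>) z" using above by blast
    obtain t where t: "t \<le> min K z" "regen_upto (lengths \<omega>) z t" using below by blast
    have "int (L s \<omega>) \<le> s - t" if "s \<ge> t" for s
    proof (cases "s \<le> z")
      case True
      with t that show ?thesis by (simp add: regen_upto_def)
    next
      case False
      then have "int (L s \<omega>) \<le> s - z" using z by (simp add: regen_iff)
      with t show ?thesis by simp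
    qed
    with t show ?thesis by (auto simp: regen_iff)
  qed
  with above show "recurrent (lengths \<omega>)" by (auto simp: recurrent_def)
qed

end

section \<open>The last time regenerating up to the end of the window\<close>

text \<open>\<open>T[m,n]\<close> as an integer, on the event that some \<open>t \<le> m\<close>
  qualifies. Minimising the distance \<open>k\<close> back from \<open>m\<close> replaces the
  supremum by a \<open>LEAST\<close> over \<open>nat\<close>, whose measurability is direct.\<close>

definition last_regen :: "(int \<Rightarrow> nat) \<Rightarrow> int \<Rightarrow> int \<Rightarrow> int" where
  "last_regen l m n = m - int (LEAST k. regen_upto l n (m - int k))"

lemma last_regen:
  assumes "\<exists>t\<le>m. regen_upto l n t"
  shows "last_regen l m n \<le> m" "regen_upto l n (last_regen l m n)"
    "\<And>u. last_regen l m n < u \<Longrightarrow> u \<le> m \<Longrightarrow> \<not> regen_upto l n u"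
proof -
  obtain t where t: "t \<le> m" "regen_upto l n t" using assms by blast
  then have "regen_upto l n (m - int (nat (m - t)))" by simp
  then show "regen_upto l n (last_regen l m n)"
    unfolding last_regen_def by (rule LeastI)
  show "last_regen l m n \<le> m" by (simp add: last_regen_def)
  fix u assume u: "last_regen l m n < u" "u \<le> m"
  then have "\<not> regen_upto l n (m - int (nat (m - u)))"
    by (intro not_less_Least[where P = "\<lambda>k. regen_upto l n (m - int k)"]) (auto simp: last_regen_def)
  with u show "\<not> regen_upto l n u" by simp
qed

lemma T_window_altdef: "T_window l m n = Sup ((\<lambda>t. ereal (real_of_int t)) ` {t. t \<le> m \<and> regen_upto l n t})"
  by (simp add: T_window_def regen_upto_def)

lemma T_window_eq_last_regen:
  assumes "\<exists>t\<le>m. regen_upto l n t"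
  shows "T_window l m n = ereal (real_of_int (last_regen l m n))"
  unfolding T_window_altdef
proof (rule Sup_eqI)
  fix y assume "y \<in> (\<lambda>t. ereal (real_of_int t)) ` {t. t \<le> m \<and> regen_upto l n t}"
  then show "y \<le> ereal (real_of_int (last_regen l m n))"
    using last_regen(3)[OF assms] by (force simp: not_less[symmetric])
qed (use last_regen[OF assms] in auto)

text \<open>The right side involves only lengths at times \<open>t..n\<close>, which yields claim
  (b). If no time qualifies, the supremum is minus infinity and both sides fail.\<close>

lemma T_window_eq_iff:
  assumes "t \<le> m"
  shows "T_window l m n = ereal (real_of_int t) \<longleftrightarrow>
    regen_upto l n t \<and> (\<forall>u\<in>{t<..m}. \<not> regen_upto l n u)"
proof (cases "\<exists>t\<le>m. regen_upto l n t")
  case True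
  then show ?thesis
    using last_regen[OF True] assms
    by (simp add: T_window_eq_last_regen) (metis greaterThanAtMost_iff linorder_neqE)
next
  case False
  then have none: "{t. t \<le> m \<and> regen_upto l n t} = {}" by auto
  have "T_window l m n = -\<infinity>"
    unfolding T_window_altdef none by (simp add: bot_ereal_def)
  with False assms show ?thesis by auto
qed

section \<open>The perfect simulation algorithm\<close>

text \<open>Both total masses are one, so the inequalities at \<open>x\<close> and on its complement
  must be equalities.\<close>

lemma pmf_eqI_le:
  assumes le: "\<And>x. pmf p x \<le> pmf q x"
  shows "p = q"
proof (rule pmf_eqI)
  fix x
  have "emeasure p (- {x}) \<le> emeasure q (- {x})"
    unfolding nn_integral_pmf[symmetric] by (intro nn_integral_mono) (simp add: le)
  then have "measure p (- {x}) \<le> measure q (- {x})"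
    by (simp add: measure_pmf.emeasure_eq_measure)
  moreover have "measure r (- {x}) = 1 - pmf r x" for r :: "'a pmf"
    using measure_pmf.prob_compl[of "{x}" r] by (simp add: Compl_eq_Diff_UNIV measure_pmf_single)
  ultimately show "pmf p x = pmf q x" using le[of x] by simp
qed

lemma pmf_bind_ge: "pmf p x * pmf (f x) y \<le> pmf (bind_pmf p f) y"
proof -
  have "ennreal (pmf p x * pmf (f x) y) = (\<integral>\<^sup>+z. ennreal (pmf (f x) y) * indicator {x} z \<partial>p)"
    by (simp add: nn_integral_cmult_indicator emeasure_pmf_single ennreal_mult mult.commute)
  also have "\<dots> \<le> (\<integral>\<^sup>+z. ennreal (pmf (f z) y) \<partial>p)"
    by (intro nn_integral_mono) (auto simp: indicator_def)
  also have "\<dots> = ennreal (pmf (bind_pmf p f) y)"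
    by (rule ennreal_pmf_bind[symmetric])
  finally show ?thesis by simp
qed

text \<open>Follow the search along the trajectory \<open>l\<close>. It does not stop before
  reaching \<open>t\<close>, because no later time up to \<open>m\<close> qualifies, and it stops at
  \<open>t\<close>; each of the \<open>d\<close> draws gives the prescribed value with probability
  \<open>pmf \<Lambda> (l s)\<close>. Other draws are discarded, hence the inequality.\<close>

lemma search_ge:
  assumes "t \<le> m" "m \<le> n" "regen_upto l n t" "\<And>u. t < u \<Longrightarrow> u \<le> m \<Longrightarrow> \<not> regen_upto l n u"
    and "t + int d \<le> n + 1"
  shows "(\<Prod>s\<in>{t..<t + int d}. pmf \<Lambda> (l s))
    \<le> spmf (search \<Lambda> m (t + int d) (map l [t + int d..n])) (t, map l [t..n])"
  using assms(5)
proof (induction d)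
  case 0
  then show ?case
    using assms(1,3) unfolding regen_upto_iff_nth
    by (simp add: search.simps[of _ m t] del: nth_map length_upto)
next
  case (Suc d)
  let ?u = "t + int d"
  let ?f = "\<lambda>x. search \<Lambda> m ?u (x # map l [?u + 1..n])"
  have "{t..<t + int (Suc d)} = insert ?u {t..<?u}" by auto
  then have "(\<Prod>s\<in>{t..<t + int (Suc d)}. pmf \<Lambda> (l s)) = pmf \<Lambda> (l ?u) * (\<Prod>s\<in>{t..<?u}. pmf \<Lambda> (l s))"
    by simp
  also have "\<dots> \<le> pmf \<Lambda> (l ?u) * spmf (search \<Lambda> m ?u (map l [?u..n])) (t, map l [t..n])"
    using Suc by (intro mult_left_mono) auto
  also have "map l [?u..n] = l ?u # map l [?u + 1..n]"
    using Suc.prems by (simp add: upto_rec1)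
  also have "pmf \<Lambda> (l ?u) * spmf (?f (l ?u)) (t, map l [t..n]) \<le> spmf (bind_pmf \<Lambda> ?f) (t, map l [t..n])"
    by (rule pmf_bind_ge)
  \<comment> \<open>The test fails at \<open>?u + 1\<close>, which is later than \<open>t\<close>,
    so the search unfolds to one more draw.\<close>
  also have "bind_pmf \<Lambda> ?f = search \<Lambda> m (t + int (Suc d)) (map l [t + int (Suc d)..n])"
  proof -
    have u: "t + int (Suc d) = ?u + 1" by simp
    have "\<not> (?u + 1 \<le> m \<and> regen_upto l n (?u + 1))"
      using assms(4)[of "?u + 1"] by linarith
    then show ?thesis
      unfolding u search.simps[of \<Lambda> m "?u + 1"] length_map regen_upto_iff_nth[symmetric]
      by (simp only: if_False bind_spmf_of_pmf add_diff_cancel_right')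
  qed
  finally show ?case .
qed

section \<open>The law of the search and of its output\<close>

context context_lengths
begin

lemma AE_regen_upto_le: "AE \<omega> in M. \<exists>t\<le>m. regen_upto (lengths \<omega>) n t"
  using AE_regen_upto_below by eventually_elim blast

lemma T_window_measurable:
  assumes "t \<le> m"
  shows "{\<omega> \<in> space M. T_window (lengths \<omega>) m n = ereal (real_of_int t)} \<in>
    sigma_sets (space M) {L s -` A \<inter> space M | s A. s \<in> {t..n}}"
    (is "_ \<in> sigma_sets _ ?G")
proof -
  interpret G: sigma_algebra "space M" "sigma_sets (space M) ?G"
    by (rule sigma_algebra_sigma_sets) auto
  have gen: "{\<omega> \<in> space M. L s \<omega> \<in> B} \<in> sigma_sets (space M) ?G" if "s \<in> {t..n}" for s B
    using that by (intro sigma_sets.Basic) blast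
  have regen: "{\<omega> \<in> space M. regen_upto (lengths \<omega>) n u} \<in> sigma_sets (space M) ?G" if "t \<le> u" for u
    unfolding regen_upto_altdef
  proof (intro G.sets_Collect_finite_All)
    fix s assume "s \<in> {u..n}"
    with that show "{\<omega> \<in> space M. L s \<omega> \<in> {..nat (s - u)}} \<in> sigma_sets (space M) ?G"
      by (intro gen) simp
  qed simp
  have "{\<omega> \<in> space M. \<forall>u\<in>{t<..m}. \<not> regen_upto (lengths \<omega>) n u} \<in> sigma_sets (space M) ?G"
  proof (rule G.sets_Collect_finite_All)
    fix u assume "u \<in> {t<..m}"
    then show "{\<omega> \<in> space M. \<not> regen_upto (lengths \<omega>) n u} \<in> sigma_sets (space M) ?G"
      by (intro G.sets_Collect_neg regen) simp
  qed simp
  with regen[OF order_refl] show ?thesis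
    unfolding T_window_eq_iff[OF assms] by (intro G.sets_Collect_conj)
qed

text \<open>The result of \<open>search\<close> when the draws are taken from \<open>L\<close>; its
  distribution under \<open>M\<close> is the reference with which \<open>search\<close> is
  compared.\<close>

definition outcome :: "int \<Rightarrow> int \<Rightarrow> 'w \<Rightarrow> int \<times> nat list" where
  "outcome m n \<omega> = (let t = last_regen (lengths \<omega>) m n in (t, map (lengths \<omega>) [t..n]))"

lemma measurable_outcome: "outcome m n \<in> measurable M (count_space UNIV)"
proof -
  have "Measurable.pred M (\<lambda>\<omega>. regen_upto (lengths \<omega>) n t)" for t
    using sets_regen_upto[of n t] by (simp add: pred_def)
  then have 1: "(\<lambda>\<omega>. LEAST k. regen_upto (lengths \<omega>) n (m - int k)) \<in> measurable M (count_space UNIV)"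
    by (intro measurable_Least)
  \<comment> \<open>With the value of the \<open>LEAST\<close> held fixed, the list runs over fixed
    times; the countably many values are combined afterwards.\<close>
  have 2: "(\<lambda>\<omega>. (m - int k, map (lengths \<omega>) [m - int k..n])) \<in> measurable M (count_space UNIV)" for k
    by (rule measurable_compose[OF measurable_map_list[OF measurable_L]]) simp
  from measurable_compose_countable[OF 2 1] show ?thesis
    by (simp add: outcome_def[abs_def] Let_def last_regen_def)
qed

text \<open>The search returns each outcome with at least its probability under \<open>M\<close>. The outcomes have
  total mass one, so the two laws agree and no mass is lost to nontermination.\<close>

lemma search_law:
  assumes "m \<le> n"
  obtains Q where "measure_pmf Q = distr M (count_space UNIV) (outcome m n)"
    "search \<Lambda> m (n + 1) [] = spmf_of_pmf Q"
proof -
  let ?D = "distr M (count_space UNIV) (outcome m n)"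
  interpret D: prob_space ?D by (rule prob_space_distr[OF measurable_outcome])
  have "AE x in ?D. measure ?D {x} \<noteq> 0"
    by (subst D.AE_support_countable) (auto intro!: exI[of _ UNIV])
  then have Q: "measure_pmf (Abs_pmf ?D) = ?D"
    by (intro Abs_pmf_inverse) (simp add: D.prob_space_axioms)
  have le: "pmf (Abs_pmf ?D) x \<le> spmf (search \<Lambda> m (n + 1) []) x" for x
  proof -
    have pmf_eq: "pmf (Abs_pmf ?D) x = prob {\<omega> \<in> space M. outcome m n \<omega> = x}"
      unfolding measure_pmf_single[symmetric] Q
      by (subst measure_distr[OF measurable_outcome]) (auto simp: vimage_def Int_def conj_commute)
    show ?thesis
    proof (cases "\<exists>\<omega>\<in>space M. (\<exists>t\<le>m. regen_upto (lengths \<omega>) n t) \<and> outcome m n \<omega> = x")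
      case True
      then obtain \<omega> where ex: "\<exists>t\<le>m. regen_upto (lengths \<omega>) n t" and x: "outcome m n \<omega> = x"
        by blast
      let ?t = "last_regen (lengths \<omega>) m n"
      have x': "x = (?t, map (lengths \<omega>) [?t..n])"
        using x by (simp add: outcome_def Let_def)
      have t: "?t \<le> m" using last_regen(1)[OF ex] .
      \<comment> \<open>The outcome fixes \<open>L\<close> on \<open>{?t..n}\<close>, so its event
        lies in a cylinder whose probability is exactly the lower bound in
        \<open>search_ge\<close>.\<close>
      have "prob {\<omega>' \<in> space M. outcome m n \<omega>' = x} \<le> prob {\<omega>' \<in> space M. \<forall>s\<in>{?t..n}. L s \<omega>' \<in> {L s \<omega>}}"
      proof (rule finite_measure_mono)
        show "{\<omega>' \<in> space M. outcome m n \<omega>' = x} \<subseteq> {\<omega>' \<in> space M. \<forall>s\<in>{?t..n}. L s \<omega>' \<in> {L s \<omega>}}"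
          by (auto simp: x' outcome_def Let_def)
        show "{\<omega>' \<in> space M. \<forall>s\<in>{?t..n}. L s \<omega>' \<in> {L s \<omega>}} \<in> events"
          by (rule sets_lengths) simp
      qed
      also have "\<dots> = (\<Prod>s\<in>{?t..n}. pmf \<Lambda> (L s \<omega>))"
        by (subst prob_lengths) (simp_all add: measure_pmf_single)
      also have "{?t..n} = {?t..<?t + int (nat (n + 1 - ?t))}"
        using t assms by auto
      also have "(\<Prod>s\<in>\<dots>. pmf \<Lambda> (L s \<omega>)) \<le> spmf (search \<Lambda> m (?t + int (nat (n + 1 - ?t)))
          (map (lengths \<omega>) [?t + int (nat (n + 1 - ?t))..n])) (?t, map (lengths \<omega>) [?t..n])"
        using last_regen[OF ex] assms by (intro search_ge) auto
      also have "?t + int (nat (n + 1 - ?t)) = n + 1" using t assms by simp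
      finally show ?thesis unfolding pmf_eq by (simp add: x')
    next
      case False
      \<comment> \<open>Such an \<open>x\<close> arises at most on the null event that no time
        qualifies.\<close>
      have "AE \<omega> in M. \<not> (outcome m n \<omega> = x)"
        using AE_regen_upto_le[of m n] AE_space by eventually_elim (use False in auto)
      then have "prob {\<omega> \<in> space M. outcome m n \<omega> = x} = 0"
        using measurable_sets[OF measurable_outcome, of "{x}" m n]
        by (subst prob_eq_0) (auto simp: vimage_def Int_def conj_commute)
      then show ?thesis by (simp add: pmf_eq)
    qed
  qed
  have "spmf_of_pmf (Abs_pmf ?D) = search \<Lambda> m (n + 1) []"
  proof (rule pmf_eqI_le)
    \<comment> \<open>At \<open>None\<close> the left side is 0, so the comparison on proper results
      is enough; the equality obtained then gives almost sure termination.\<close>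
    fix y show "pmf (spmf_of_pmf (Abs_pmf ?D)) y \<le> pmf (search \<Lambda> m (n + 1) []) y"
      using le by (cases y) (simp_all add: pmf_spmf_of_pmf_None)
  qed
  with Q show ?thesis using that by metis
qed

lemma perfect_simulation_law:
  assumes "m \<le> n" and Q: "search \<Lambda> m (n + 1) [] = spmf_of_pmf Q"
  shows "perfect_simulation \<Lambda> P0 Pk m n = spmf_of_pmf (bind_pmf Q (\<lambda>(t, ls).
      map_pmf (\<lambda>xs. (xs, t)) (window_law P0 Pk m t ls)))"
  by (simp add: perfect_simulation_def Q spmf_of_pmf_bind window_law_def pmf.map_comp o_def
      bind_pmf_return_spmf case_prod_unfold)

text \<open>Given \<open>L\<close>, the coupling generates the window from a regeneration time and
  the algorithm from \<open>last_regen\<close>. These laws agree by \<open>window_law_eq\<close>,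
  and averaging over \<open>L\<close> gives the law of the window.\<close>

lemma emeasure_window:
  assumes "m \<le> n" "minimal_dbar_coupling P0 Pk M L Z"
  shows "emeasure M {\<omega> \<in> space M. map (\<lambda>i. Z i \<omega>) [m..n] = v}
    = (\<integral>\<^sup>+\<omega>. pmf (case_prod (window_law P0 Pk m) (outcome m n \<omega>)) v \<partial>M)"
proof -
  let ?B = "{z. map z [m..n] = v}"
  have "?B \<in> sets seqs" by (rule sets_map_eq)
  \<comment> \<open>Taking \<open>UNIV\<close> as the set of lengths removes the constraint on
    \<open>L\<close> from the defining identity of the coupling.\<close>
  moreover have "UNIV \<in> sets (seqs :: (int \<Rightarrow> nat) measure)"
    using sets.top[of "seqs :: (int \<Rightarrow> nat) measure"] by (simp add: space_PiM)
  ultimately have "emeasure M {\<omega> \<in> space M. map (\<lambda>i. Z i \<omega>) [m..n] = v}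
      = (\<integral>\<^sup>+\<omega>. emeasure (coupling_given P0 Pk (lengths \<omega>)) ?B \<partial>M)"
    using assms(2)[unfolded minimal_dbar_coupling_def] by force
  also have "\<dots> = (\<integral>\<^sup>+\<omega>. pmf (case_prod (window_law P0 Pk m) (outcome m n \<omega>)) v \<partial>M)"
  proof (rule nn_integral_cong_AE)
    show "AE \<omega> in M. emeasure (coupling_given P0 Pk (lengths \<omega>)) ?B
      = ennreal (pmf (case_prod (window_law P0 Pk m) (outcome m n \<omega>)) v)"
      using AE_recurrent AE_regen_upto_le[of m n]
    proof eventually_elim
      fix \<omega> assume rec: "recurrent (lengths \<omega>)" and ex: "\<exists>t\<le>m. regen_upto (lengths \<omega>) n t"
      obtain t where t: "t \<le> m" "regen (lengths \<omega>) t"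
        and eq: "\<And>v. emeasure (coupling_given P0 Pk (lengths \<omega>)) {z. map z [m..n] = v}
          = ennreal (pmf (window_law P0 Pk m t (map (lengths \<omega>) [t..n])) v)"
        by (rule coupling_given_window[OF rec assms(1)]) blast
      \<comment> \<open>A regeneration time up to \<open>m\<close> also regenerates up to
        \<open>n\<close>, so it cannot exceed the last time that does.\<close>
      have "t \<le> last_regen (lengths \<omega>) m n"
        using last_regen(3)[OF ex, of t] t regen_imp_regen_upto by (meson not_less)
      then show "emeasure (coupling_given P0 Pk (lengths \<omega>)) ?B
        = ennreal (pmf (case_prod (window_law P0 Pk m) (outcome m n \<omega>)) v)"
        using window_law_eq[OF _ _ assms(1), of t "last_regen (lengths \<omega>) m n"] last_regen[OF ex]
        by (simp add: eq outcome_def Let_def)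
    qed
  qed
  finally show ?thesis .
qed

end

section \<open>Assembly of the claims (a) to (d)\<close>

theorem theorem1:
  fixes MX :: "'x measure" and X :: "int \<Rightarrow> 'x \<Rightarrow> bool" and pX :: "bool past \<Rightarrow> bool pmf"
    and MY :: "'y measure" and Y :: "int \<Rightarrow> 'y \<Rightarrow> bool" and pY :: "bool past \<Rightarrow> bool pmf"
    and P0 :: "sym pmf" and Pk :: "nat \<Rightarrow> sym list \<Rightarrow> sym pmf"
    and M :: "'w measure" and L :: "int \<Rightarrow> 'w \<Rightarrow> nat"
    and m n :: int
  assumes X: "stationary_chain MX X pX"
    and Y: "stationary_chain MY Y pY"
    and ordering: "\<And>x y. x \<le> y \<Longrightarrow> pmf (pX x) True \<le> pmf (pY y) True"
    and continuity: "(\<lambda>k. max (beta pX k) (beta pY k)) \<longlonglongrightarrow> 0"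
    and prod_pos: "\<exists>c>0. alpha pX pY has_prod c"
    and decomp: "decomposition pX pY P0 Pk"
    and M: "prob_space M"
    and L_indep: "prob_space.indep_vars M (\<lambda>_. count_space UNIV) L UNIV"
    and L_law: "\<And>i k. measure M {\<omega> \<in> space M. L i \<omega> = k} = lam pX pY k"
    and mn: "m \<le> n"
  shows
    "(AE \<omega> in M. \<bar>T_window (\<lambda>i. L i \<omega>) m n\<bar> \<noteq> \<infinity>) \<and>
     (\<forall>t\<le>m. {\<omega> \<in> space M. T_window (\<lambda>i. L i \<omega>) m n = ereal (real_of_int t)} \<in>
        sigma_sets (space M) {L s -` A \<inter> space M | s A. s \<in> {t..n}}) \<and>
     lossless_spmf (perfect_simulation (embed_pmf (lam pX pY)) P0 Pk m n) \<and>
     (\<forall>Z. minimal_dbar_coupling P0 Pk M L Z \<longrightarrow>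
        measure_spmf (map_spmf fst (perfect_simulation (embed_pmf (lam pX pY)) P0 Pk m n))
        = distr M (count_space UNIV) (\<lambda>\<omega>. map (\<lambda>i. Z i \<omega>) [m..n]))"
proof -
  interpret prob_space M by (rule M)
  define \<Lambda> where "\<Lambda> = embed_pmf (lam pX pY)"
  have L_meas: "L i \<in> measurable M (count_space UNIV)" for i
    using L_indep by (simp add: indep_vars_def2)
  have distr_L: "distr M (count_space UNIV) (L i) = measure_pmf \<Lambda>" and lam: "pmf \<Lambda> = lam pX pY" for i
  proof -
    let ?D = "\<lambda>i. distr M (count_space UNIV) (L i)"
    \<comment> \<open>That \<open>lam\<close> is a probability distribution is read off from its
      being the law of \<open>L i\<close>, so \<open>embed_pmf\<close> has it as its mass
      function.\<close>
    have law: "emeasure (?D i) {k} = ennreal (lam pX pY k)" for i k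
      unfolding L_law[of i k, symmetric]
      by (subst emeasure_distr[OF L_meas]) (auto simp: emeasure_eq_measure intro!: arg_cong[where f=prob])
    have "(\<integral>\<^sup>+k. ennreal (lam pX pY k) \<partial>count_space UNIV) = emeasure (?D 0) UNIV"
      unfolding law[of 0, symmetric] by (subst emeasure_countable_singleton[symmetric]) auto
    also have "\<dots> = 1"
      using prob_space.emeasure_space_1[OF prob_space_distr[OF L_meas]] by simp
    finally have int: "(\<integral>\<^sup>+k. ennreal (lam pX pY k) \<partial>count_space UNIV) = 1" .
    have nonneg: "0 \<le> lam pX pY k" for k
      unfolding L_law[of 0 k, symmetric] by simp
    show lam: "pmf \<Lambda> = lam pX pY"
      unfolding \<Lambda>_def using pmf_embed_pmf[OF nonneg int] by blast
    show "?D i = measure_pmf \<Lambda>"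
      by (rule measure_eqI_countable[where A=UNIV]) (auto simp: law emeasure_pmf_single lam)
  qed
  \<comment> \<open>The increments telescope, so \<open>alpha\<close> is the distribution function
    of the context lengths.\<close>
  have alpha: "measure_pmf.prob \<Lambda> {..k} = alpha pX pY k" for k
  proof -
    have "measure_pmf.prob \<Lambda> {..k} = (\<Sum>j\<le>k. lam pX pY j)"
      by (simp add: measure_measure_pmf_finite lam)
    also have "\<dots> = alpha pX pY k"
      by (induction k) (simp_all add: lam_def)
    finally show ?thesis .
  qed
  obtain c where c: "c > 0" "alpha pX pY has_prod c" using prod_pos by blast
  \<comment> \<open>\<open>c > 0\<close> excludes the clause of \<open>has_prod\<close> for products
    with a zero factor, leaving plain convergence of the partial products.\<close>
  have "(\<lambda>n. \<Prod>k\<le>n. alpha pX pY k) \<longlonglongrightarrow> c"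
    using c by (auto simp: has_prod_def raw_has_prod_def)
  \<comment> \<open>The factors are probabilities, so the partial products decrease to
    \<open>c\<close> and never fall below it.\<close>
  moreover have "decseq (\<lambda>n. \<Prod>k\<le>n. alpha pX pY k)"
    unfolding alpha[symmetric] by (intro decseq_SucI) (simp add: mult_right_le_one_le prod_nonneg)
  ultimately have "c \<le> (\<Prod>k\<le>n. alpha pX pY k)" for n
    by (rule decseq_ge[rotated])
  then interpret context_lengths M L \<Lambda> c
    by unfold_locales (use L_indep distr_L c in \<open>simp_all add: alpha\<close>)
  obtain Q where Q: "measure_pmf Q = distr M (count_space UNIV) (outcome m n)"
    "search \<Lambda> m (n + 1) [] = spmf_of_pmf Q"
    by (rule search_law[OF mn])
  note sim = perfect_simulation_law[OF mn Q(2)]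
  have "AE \<omega> in M. \<bar>T_window (lengths \<omega>) m n\<bar> \<noteq> \<infinity>"
    using AE_regen_upto_le[of m n] by eventually_elim (simp add: T_window_eq_last_regen)
  moreover have "lossless_spmf (perfect_simulation \<Lambda> P0 Pk m n)"
    by (simp add: sim)
  moreover have "measure_spmf (map_spmf fst (perfect_simulation \<Lambda> P0 Pk m n))
      = distr M (count_space UNIV) (\<lambda>\<omega>. map (\<lambda>i. Z i \<omega>) [m..n])"
    if Z: "minimal_dbar_coupling P0 Pk M L Z" for Z
  proof (rule measure_eqI_countable[where A=UNIV])
    fix v :: "sym list"
    have Z_meas: "(\<lambda>\<omega>. map (\<lambda>i. Z i \<omega>) [m..n]) \<in> measurable M (count_space UNIV)"
      using Z by (intro measurable_map_list) (simp add: minimal_dbar_coupling_def)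
    have "map_spmf fst (perfect_simulation \<Lambda> P0 Pk m n)
        = spmf_of_pmf (bind_pmf Q (case_prod (window_law P0 Pk m)))"
      by (simp add: sim map_bind_pmf pmf.map_comp o_def case_prod_unfold)
    then have "emeasure (measure_spmf (map_spmf fst (perfect_simulation \<Lambda> P0 Pk m n))) {v}
        = (\<integral>\<^sup>+x. pmf (case_prod (window_law P0 Pk m) x) v \<partial>Q)"
      by (simp add: emeasure_pmf_single ennreal_pmf_bind)
    \<comment> \<open>\<open>Q\<close> is the law of \<open>outcome\<close>, so the average over
      \<open>Q\<close> becomes the integral in \<open>emeasure_window\<close>.\<close>
    also have "\<dots> = (\<integral>\<^sup>+\<omega>. pmf (case_prod (window_law P0 Pk m) (outcome m n \<omega>)) v \<partial>M)"
      unfolding Q(1) by (rule nn_integral_distr[OF measurable_outcome]) simp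
    also have "\<dots> = emeasure (distr M (count_space UNIV) (\<lambda>\<omega>. map (\<lambda>i. Z i \<omega>) [m..n])) {v}"
      unfolding emeasure_window[OF mn Z, symmetric]
      by (subst emeasure_distr[OF Z_meas]) (auto intro!: arg_cong2[where f=emeasure])
    finally show "emeasure (measure_spmf (map_spmf fst (perfect_simulation \<Lambda> P0 Pk m n))) {v}
        = emeasure (distr M (count_space UNIV) (\<lambda>\<omega>. map (\<lambda>i. Z i \<omega>) [m..n])) {v}" .
  qed auto
  ultimately show ?thesis
    using T_window_measurable unfolding \<Lambda>_def by blast
qed

end
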